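(* Let $d\ge2$, $\beta>0$, $\Lambda>0$ and $0<\kappa^-<\infty$. Let $\mathcal P$ be the collection of all pairs $(p,q)$ of bounded probability densities on $[0,1]^d$ whose Bayes region $G^*$ belongs to the smooth boundary fragment class $\mathcal G^*_\beta$, which satisfy $\inf_{\mathbf x\in\partial G^*}K(\mathbf x)=\kappa^-$, and for which there exist $\epsilon_0>0$ small enough and $0<C_{\epsilon_0}<\infty$ such that for all $\mathbf x\in\partial G^*$ and all $0<|t|<\epsilon_0$, $\frac1{C_{\epsilon_0}}\le\frac{m_{\mathbf x}(t)}{|t|^{1/K(\mathbf x)}}\le C_{\epsilon_0}$. Then for any function space $\mathcal F$ (estimators $\hat f$ being data-dependent elements of $\mathcal F$ built from $n$ i.i.d. observations), $$\inf_{\hat f\in\mathcal F}\ \sup_{(p,q)\in\mathcal P}\ \mathbb E\big[\mathcal E(\hat f,G^* )\big]\ \gtrsim\ \left(\frac1n\right)^{\frac{\beta(\kappa^-+1)}{\beta(\kappa^-+2)+(d-1)\kappa^-}} .$$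
   Context: Classification setting: $y\in\{-1,1\}$ with $\mathbb P(y=1)=1/2$, $\mathbf x\mid y=1\sim p$, $\mathbf x\mid y=-1\sim q$, with $p,q$ bounded densities on $\mathcal X=[0,1]^d$. The data are $n$ i.i.d. copies $(\mathbf x_i,y_i)$. A real function $f$ gives the classifier $\mathrm{sign}(f)$; a set $G$ gives the classifier assigning label $1$ on $G$ and $-1$ off $G$. The risk is $R(C)=\mathbb P(C(\mathbf x)\ne y)$; the Bayes region is $G^*=\{\mathbf x:p(\mathbf x)-q(\mathbf x)\ge0\}$; the excess risk is $\mathcal E(\hat f,G^* )=R(\hat f)-R(G^* )$ (equivalently, up to a constant factor, $\int_{\hat G\triangle G^*}|p-q|\,d\mathbf x$ where $\hat G$ is the set labelled $1$). $a_n\gtrsim b_n$ means $a_n\ge c\,b_n$ for a constant $c>0$ and all sufficiently large $n$. Hölder ball: $\lfloor\beta\rfloor$ is the largest integer strictly smaller than $\beta$; $\mathcal H(k,\beta,\Lambda)$ is the set of $f:\mathbb R^k\to\mathbb R$ with $\sum_{|\alpha|<\beta}\|\partial^\alpha f\|_\infty+\sum_{|\alpha|=\lfloor\beta\rfloor}\sup_{\mathbf x\ne \mathbf y}\frac{|\partial^\alpha f(\mathbf x)-\partial^\alpha f(\mathbf y)|}{|\mathbf x-\mathbf y|_\infty^{\beta-\lfloor\beta\rfloor}}\le\Lambda$. Boundary fragments: with $\mathbf x_{-d}=(x_1,\dots,x_{d-1})$, $\mathcal G^*_\beta$ is the class of sets $\{\mathbf x\in[0,1]^d:f^*(\mathbf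 x_{-d})-x_d\ge0\}$ with $f^*\in\mathcal H(d-1,\beta,\Lambda)$. The decision boundary is $\partial G^*=\{\mathbf x\in[0,1]^d:f^*(\mathbf x_{-d})=x_d\}$, assumed Lebesgue-null. Localized separation: for $\mathbf x=(\mathbf x_{-d},f^*(\mathbf x_{-d}))\in\partial G^*$, $m_{\mathbf x}(t)=|p(\mathbf x_{-d},f^*(\mathbf x_{-d})+t)-q(\mathbf x_{-d},f^*(\mathbf x_{-d})+t)|$ for those $t$ with the point in $[0,1]^d$ (and $m_{\mathbf x}(0)=0$ by definition), and $K(\mathbf x)=\sup\{k\ge0:\lim_{t\to0}m_{\mathbf x}(t)/|t|^{1/k}>0\}$. (M1): there exist $\epsilon_0>0$ small enough and $0<C_{\epsilon_0}<\infty$ such that for all $\mathbf x\in\partial G^*$ and all $0<|t|<\epsilon_0$, $\frac1{C_{\epsilon_0}}\le\frac{m_{\mathbf x}(t)}{|t|^{1/K(\mathbf x)}}\le C_{\epsilon_0}$. *)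

theory Defs
  imports "HOL-Probability.Probability"
begin

text \<open>
  A point of \<open>\<real>\<^sup>d\<close> is written as the pair of its first \<open>d - 1\<close> coordinates (a vector indexed by
  \<open>'m\<close>, so \<open>CARD('m) = d - 1\<close>) and its last coordinate.
\<close>

type_synonym 'm point = "(real ^ 'm) \<times> real"

type_synonym 'm dataset = "nat \<Rightarrow> 'm point \<times> int"

definition unit_cube :: "'m::finite point set" where
  "unit_cube = {x. (\<forall>i. fst x $ i \<in> {0..1}) \<and> snd x \<in> {0..1}}"

definition cube_measure :: "'m::finite point measure" where
  "cube_measure = restrict_space lborel unit_cube"

text \<open>The largest integer \<^emph>\<open>strictly\<close> smaller than \<open>\<beta>\<close> (for \<open>\<beta> > 0\<close>).\<close>

definition strict_floor :: "real \<Rightarrow> nat" where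
  "strict_floor \<beta> = nat (\<lceil>\<beta>\<rceil> - 1)"

text \<open>
  A multi-index is a function \<open>'m \<Rightarrow> nat\<close>.  \<open>partials k f D\<close> says that \<open>f\<close> has all partial derivatives
  up to order \<open>k\<close> and that \<open>D \<alpha>\<close> is the derivative with multi-index \<open>\<alpha>\<close>, for \<open>\<bar>\<alpha>\<bar> \<le> k\<close>.
  These values of \<open>D\<close> are determined by \<open>f\<close>; the others are irrelevant.
\<close>

definition partials ::
    "nat \<Rightarrow> (real ^ 'm \<Rightarrow> real) \<Rightarrow> (('m::finite \<Rightarrow> nat) \<Rightarrow> real ^ 'm \<Rightarrow> real) \<Rightarrow> bool" where
  "partials k f D \<longleftrightarrow>
     D (\<lambda>_. 0) = f \<and>
     (\<forall>\<alpha> i x. sum \<alpha> UNIV < k \<longrightarrow>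
        ((\<lambda>t. D \<alpha> (x + t *\<^sub>R axis i 1)) has_real_derivative D (\<alpha>(i := Suc (\<alpha> i))) x) (at 0))"

text \<open>
  The norm is taken in \<open>[0, \<infinity>]\<close>, so that unbounded suprema are \<open>\<infinity>\<close>.
\<close>

definition holder_norm ::
    "real \<Rightarrow> (('m::finite \<Rightarrow> nat) \<Rightarrow> real ^ 'm \<Rightarrow> real) \<Rightarrow> ennreal" where
  "holder_norm \<beta> D =
     (\<Sum>\<alpha> \<in> {\<alpha>. real (sum \<alpha> UNIV) < \<beta>}. SUP x. ennreal \<bar>D \<alpha> x\<bar>) +
     (\<Sum>\<alpha> \<in> {\<alpha>. sum \<alpha> UNIV = strict_floor \<beta>}.
        SUP (x, y) \<in> {(x, y). x \<noteq> y}.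
          ennreal (\<bar>D \<alpha> x - D \<alpha> y\<bar> / infnorm (x - y) powr (\<beta> - real (strict_floor \<beta>))))"

definition holder_ball :: "real \<Rightarrow> real \<Rightarrow> (real ^ 'm::finite \<Rightarrow> real) set" where
  "holder_ball \<beta> \<Lambda> = {f. \<exists>D. partials (strict_floor \<beta>) f D \<and> holder_norm \<beta> D \<le> ennreal \<Lambda>}"

definition fragment :: "(real ^ 'm \<Rightarrow> real) \<Rightarrow> 'm::finite point set" where
  "fragment f = {x \<in> unit_cube. f (fst x) - snd x \<ge> 0}"

definition boundary :: "(real ^ 'm \<Rightarrow> real) \<Rightarrow> 'm::finite point set" where
  "boundary f = {x \<in> unit_cube. f (fst x) = snd x}"

text \<open>Only the values on the unit cube matter.\<close>

definition bounded_density :: "('m::finite point \<Rightarrow> real) \<Rightarrow> bool" where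
  "bounded_density p \<longleftrightarrow>
     p \<in> borel_measurable cube_measure \<and>
     (\<forall>x\<in>unit_cube. p x \<ge> 0) \<and>
     (\<exists>B. \<forall>x\<in>unit_cube. p x \<le> B) \<and>
     (\<integral>x. p x \<partial>cube_measure) = 1"

definition bayes_region :: "('m point \<Rightarrow> real) \<Rightarrow> ('m point \<Rightarrow> real) \<Rightarrow> 'm::finite point set" where
  "bayes_region p q = {x \<in> unit_cube. p x - q x \<ge> 0}"

definition shift_last :: "'m::finite point \<Rightarrow> real \<Rightarrow> 'm point" where
  "shift_last x t = (fst x, snd x + t)"

definition sep ::
    "('m point \<Rightarrow> real) \<Rightarrow> ('m point \<Rightarrow> real) \<Rightarrow> 'm::finite point \<Rightarrow> real \<Rightarrow> real" where
  "sep p q x t = (if t = 0 then 0 else \<bar>p (shift_last x t) - q (shift_last x t)\<bar>)"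

text \<open>
  The limit may be \<open>\<infinity>\<close> (as it is for every \<open>k\<close> below the critical exponent), and the supremum
  lives in \<open>[0, \<infinity>]\<close>, where \<open>Sup {} = 0\<close>.  Hence it is immaterial how \<open>1 / k\<close> is read for \<open>k = 0\<close>.
\<close>

definition sep_exponent ::
    "('m point \<Rightarrow> real) \<Rightarrow> ('m point \<Rightarrow> real) \<Rightarrow> 'm::finite point \<Rightarrow> ennreal" where
  "sep_exponent p q x =
     Sup {ennreal k | k. k \<ge> 0 \<and>
       (\<exists>L::ereal. L > 0 \<and>
         ((\<lambda>t. ereal (sep p q x t / \<bar>t\<bar> powr (1 / k))) \<longlongrightarrow> L)
           (at 0 within {t. shift_last x t \<in> unit_cube}))}"

text \<open>If \<open>sep_exponent p q x = \<infinity>\<close>, the exponent \<open>1 / sep_exponent p q x\<close> is \<open>0\<close>.\<close>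

definition localized_margin ::
    "('m point \<Rightarrow> real) \<Rightarrow> ('m point \<Rightarrow> real) \<Rightarrow> (real ^ 'm::finite \<Rightarrow> real) \<Rightarrow> bool" where
  "localized_margin p q f \<longleftrightarrow>
     (\<exists>\<epsilon>>0. \<exists>C>0. \<forall>x\<in>boundary f. \<forall>t.
        0 < \<bar>t\<bar> \<and> \<bar>t\<bar> < \<epsilon> \<and> shift_last x t \<in> unit_cube \<longrightarrow>
          1 / C \<le> sep p q x t / \<bar>t\<bar> powr enn2real (1 / sep_exponent p q x) \<and>
          sep p q x t / \<bar>t\<bar> powr enn2real (1 / sep_exponent p q x) \<le> C)"

definition pair_class ::
    "real \<Rightarrow> real \<Rightarrow> real \<Rightarrow> (('m::finite point \<Rightarrow> real) \<times> ('m point \<Rightarrow> real)) set" where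
  "pair_class \<beta> \<Lambda> \<kappa> =
     {(p, q). bounded_density p \<and> bounded_density q \<and>
        (\<exists>f \<in> holder_ball \<beta> \<Lambda>.
           bayes_region p q = fragment f \<and>
           boundary f \<in> null_sets lborel \<and>
           (INF x \<in> boundary f. sep_exponent p q x) = ennreal \<kappa> \<and>
           localized_margin p q f)}"

text \<open>
  The joint law of \<open>(x, y)\<close>: the label \<open>y\<close> is \<open>1\<close> or \<open>-1\<close> with probability \<open>1/2\<close> each, and given \<open>y\<close>
  the point \<open>x\<close> has density \<open>p\<close> or \<open>q\<close>, respectively.
\<close>

definition sample_law ::
    "('m point \<Rightarrow> real) \<Rightarrow> ('m point \<Rightarrow> real) \<Rightarrow> ('m::finite point \<times> int) measure" where
  "sample_law p q =
     density (cube_measure \<Otimes>\<^sub>M count_space {-1, 1})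
       (\<lambda>(x, y). ennreal (1 / 2 * (if y = 1 then p x else q x)))"

definition data_law ::
    "('m point \<Rightarrow> real) \<Rightarrow> ('m point \<Rightarrow> real) \<Rightarrow> nat \<Rightarrow> 'm::finite dataset measure" where
  "data_law p q n = (\<Pi>\<^sub>M i \<in> {..<n}. sample_law p q)"

definition set_classifier :: "'m::finite point set \<Rightarrow> 'm point \<Rightarrow> int" where
  "set_classifier G x = (if x \<in> G then 1 else -1)"

text \<open>The sign of \<open>0\<close> is \<open>1\<close>, in accordance with the Bayes region \<open>{p - q \<ge> 0}\<close>.\<close>

definition sign_classifier :: "('m::finite point \<Rightarrow> real) \<Rightarrow> 'm point \<Rightarrow> int" where
  "sign_classifier f x = (if f x \<ge> 0 then 1 else -1)"

definition risk ::
    "('m point \<Rightarrow> real) \<Rightarrow> ('m point \<Rightarrow> real) \<Rightarrow> ('m::finite point \<Rightarrow> int) \<Rightarrow> real" where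
  "risk p q c = measure (sample_law p q) {(x, y) \<in> space (sample_law p q). c x \<noteq> y}"

definition excess_risk ::
    "('m point \<Rightarrow> real) \<Rightarrow> ('m point \<Rightarrow> real) \<Rightarrow> ('m::finite point \<Rightarrow> real) \<Rightarrow> real" where
  "excess_risk p q f =
     risk p q (sign_classifier f) - risk p q (set_classifier (bayes_region p q))"

definition expected_excess_risk ::
    "('m point \<Rightarrow> real) \<Rightarrow> ('m point \<Rightarrow> real) \<Rightarrow> nat \<Rightarrow>
      ('m::finite dataset \<Rightarrow> 'm point \<Rightarrow> real) \<Rightarrow> real" where
  "expected_excess_risk p q n fhat = (\<integral>z. excess_risk p q (fhat z) \<partial>data_law p q n)"

text \<open>
  Estimators are maps from data sets of size \<open>n\<close> to \<open>\<F>\<close>.  The only measurability imposed is what makes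
  the risks and the expected excess risks over the class \<open>\<P>\<close> meaningful.
\<close>

definition estimators ::
    "(('m point \<Rightarrow> real) \<times> ('m point \<Rightarrow> real)) set \<Rightarrow> nat \<Rightarrow> ('m::finite point \<Rightarrow> real) set \<Rightarrow>
      ('m dataset \<Rightarrow> 'm point \<Rightarrow> real) set" where
  "estimators \<P> n \<F> =
     {fhat. \<forall>(p, q) \<in> \<P>.
        (\<forall>z \<in> space (data_law p q n). fhat z \<in> \<F> \<and> fhat z \<in> borel_measurable cube_measure) \<and>
        (\<lambda>z. excess_risk p q (fhat z)) \<in> borel_measurable (data_law p q n)}"

end

theory Submission
  imports Defs "HOL-Computational_Algebra.Polynomial" "HOL-Real_Asymp.Real_Asymp"
begin

text \<open>
  Assouad's method over a hypercube of boundary fragments. Cut \<open>[0,1]^(d-1)\<close> into \<open>M^(d-1)\<close> cells and, for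
  every set \<open>W\<close> of cells, raise a constant boundary function by smooth bumps of height \<open>M^(-\<beta>)\<close> over the
  cells in \<open>W\<close>. With \<open>p = 1 + \<eta>\<close> and \<open>q = 1 - \<eta>\<close>, where \<open>\<eta>\<close> jumps from order \<open>\<Delta>\<close> to order \<open>-\<Delta>\<close> across the
  boundary, toggling one cell changes \<open>n\<close> observations by a chi-square divergence of order
  \<open>n \<Delta>\<^sup>2 M^(-\<beta>-(d-1))\<close>, while misjudging a cell costs excess risk of order \<open>\<Delta> M^(-\<beta>-(d-1))\<close>. For
  \<open>\<Delta> \<approx> M^(-\<beta>/\<kappa>)\<close> and \<open>M\<close> the coarsest resolution with bounded divergence, the total excess risk
  \<open>\<Delta> M^(-\<beta>)\<close> is the claimed rate.

  The constants in the margin condition may depend on the pair, so a jump of vanishing size \<open>\<Delta>\<close> is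
  admissible; its separation exponent is infinite. The infimum \<open>\<kappa>\<close> of the exponents is attained by
  making \<open>\<eta>\<close> behave like \<open>\<bar>t\<bar>^(1/\<kappa>)\<close> on the single null column over \<open>0\<close>.
\<close>

section \<open>Bumps in the Hoelder ball\<close>

text \<open>Since p and q must integrate to 1, the jump cannot simply go from \<Delta> to -\<Delta>:
  off the exceptional column over \<open>0\<close>, the column over x carries \<Delta> (1 - v) up to
  the frontier v = f x and -\<Delta> v above it, which has mean zero. Toggling a cell therefore
  changes \<eta> on whole columns, by \<Delta> times the bump height, and not only on the band swept
  by the frontier. For bumps of height at most u this adds a term \<Delta>^2 u^2 to the main term
  \<Delta>^2 u of the divergence, harmless because u \<le> 1/2.

  All bumps vanish at \<open>0\<close>, so the exceptional column is the same for every W and does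
  not disturb the locality of the toggles. It can carry the exponent at no cost because the
  separation conditions are pointwise, while laws and risks ignore null sets.

  The sum p + q is constant, so the points x are uniform under every hypothesis and the divergence
  comes from the labels alone. The jump M^(-\<beta>/\<kappa>) is the value of t^(1/\<kappa>) at the
  bump height t = M^(-\<beta>), the separation that a margin exponent \<kappa> would allow at that
  distance from the frontier.\<close>

lemma root_power_dvd_pderiv_iter:
  fixes p :: "real poly"
  assumes "[:-c, 1:] ^ L dvd p" "j \<le> L"
  shows "[:-c, 1:] ^ (L - j) dvd (pderiv ^^ j) p"
  using assms(2)
proof (induction j)
  case (Suc j)
  then obtain q where q: "(pderiv ^^ j) p = [:-c, 1:] ^ Suc (L - Suc j) * q"
    by (metis Suc_diff_Suc Suc_le_lessD dvdE less_imp_le)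
  have "(pderiv ^^ Suc j) p = [:-c, 1:] ^ (L - Suc j) *
      (smult (of_nat (Suc (L - Suc j))) q * pderiv [:-c, 1:] + [:-c, 1:] * pderiv q)"
    unfolding funpow.simps o_def q pderiv_mult pderiv_power_Suc
    by (simp only: distrib_left mult_smult_left mult_smult_right power_Suc mult.assoc mult.commute mult.left_commute add.commute)
  then show ?case by simp
qed (use assms(1) in simp)

text \<open>Meant for the endpoints 0 and 1, where the cut-off bump agrees with its polynomial on
  one side only: domination by a function that vanishes to first order there already forces
  derivative 0.\<close>

lemma has_derivative_zero_of_dominated:
  fixes f g :: "real \<Rightarrow> real"
  assumes "(g has_real_derivative 0) (at x)" "g x = 0" "\<And>y. \<bar>f y\<bar> \<le> \<bar>g y\<bar>"
  shows "(f has_real_derivative 0) (at x)"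
proof -
  have fx: "f x = 0" using assms(2) assms(3)[of x] by simp
  have "((\<lambda>h. (g (x + h) - g x) / h) \<longlongrightarrow> 0) (at 0)" using assms(1) by (simp add: DERIV_def)
  then have "((\<lambda>h. (f (x + h) - f x) / h) \<longlongrightarrow> 0) (at 0)"
    by (rule Lim_null_comparison[rotated, OF tendsto_norm_zero])
      (auto simp: fx assms(2) divide_right_mono assms(3))
  then show ?thesis by (simp add: DERIV_def)
qed

text \<open>The j-th derivative of the cut-off (x (1 - x))^L, for j < L. A polynomial has explicit
  derivatives, and finite smoothness is enough because only orders up to
  \<open>strict_floor \<beta> + 1\<close> occur.\<close>

definition bump :: "nat \<Rightarrow> nat \<Rightarrow> real \<Rightarrow> real" where
  "bump L j x = (if 0 < x \<and> x < 1 then poly ((pderiv ^^ j) (([:0, 1:] * [:1, -1:]) ^ L)) x else 0)"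

text \<open>Both endpoints are roots of multiplicity at least L, and each differentiation lowers the
  multiplicity by at most one.\<close>

lemma bump_poly_root:
  assumes "j < L" "x = 0 \<or> x = 1"
  shows "poly ((pderiv ^^ j) (([:0, 1:] * [:1, -1:]) ^ L)) x = (0::real)"
proof -
  have "[:-x, 1:] dvd [:0, 1:] * [:1, -1:]" using assms(2) by (auto simp: dvd_iff_poly_eq_0)
  then have "[:-x, 1:] ^ L dvd ([:0, 1:] * [:1, -1:]) ^ L" by (rule dvd_power_same)
  then have "[:-x, 1:] ^ (L - j) dvd (pderiv ^^ j) (([:0, 1:] * [:1, -1:]) ^ L)"
    using assms(1) by (intro root_power_dvd_pderiv_iter) auto
  moreover have "[:-x, 1:] dvd [:-x, 1:] ^ (L - j)" using assms(1) by (intro dvd_power) auto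
  ultimately have "[:-x, 1:] dvd (pderiv ^^ j) (([:0, 1:] * [:1, -1:]) ^ L)" by (rule dvd_trans[rotated])
  then show ?thesis by (simp add: poly_eq_0_iff_dvd)
qed

lemma bump_deriv:
  assumes "Suc j < L"
  shows "(bump L j has_real_derivative bump L (Suc j) x) (at x)"
proof -
  let ?p = "\<lambda>j. (pderiv ^^ j) (([:0, 1:] * [:1, -1:]) ^ L) :: real poly"
  have D: "(poly (?p j) has_real_derivative poly (?p (Suc j)) x) (at x)" for x
    using poly_DERIV[of "?p j"] by simp
  consider "x < 0 \<or> 1 < x" | "0 < x \<and> x < 1" | "x = 0 \<or> x = 1" by linarith
  then show ?thesis
  proof cases
    case 1
    then have "x \<in> - {0..1}" by auto
    moreover have "0 = bump L j y" if "y \<in> - {0..1}" for y using that by (auto simp: bump_def)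
    moreover have "((\<lambda>_. 0) has_real_derivative bump L (Suc j) x) (at x)"
      using 1 by (auto simp: bump_def)
    moreover have "open (- {0..1::real})" by auto
    ultimately show ?thesis by (rule has_field_derivative_transform_within_open[rotated 2])
  next
    case 2
    have "poly (?p j) y = bump L j y" if "y \<in> {0<..<1}" for y using that by (auto simp: bump_def)
    moreover have "(poly (?p j) has_real_derivative bump L (Suc j) x) (at x)"
      using 2 D by (auto simp: bump_def)
    moreover have "x \<in> {0<..<1}" "open {0<..<1::real}" using 2 by auto
    ultimately show ?thesis by (metis has_field_derivative_transform_within_open)
  next
    case 3
    \<comment> \<open>\<open>Suc j < L\<close> leaves a root for the next derivative too, so the
      dominating polynomial has value and slope 0 at the endpoint.\<close>
    have "poly (?p j) x = 0" "poly (?p (Suc j)) x = 0"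
      using assms 3 by (intro bump_poly_root; simp)+
    moreover have "bump L (Suc j) x = 0" using 3 by (auto simp: bump_def)
    ultimately show ?thesis
      using D[of x] has_derivative_zero_of_dominated[of "poly (?p j)" x "bump L j"]
      by (simp add: bump_def)
  qed
qed

lemma bump_bounded: "\<exists>B\<ge>1. \<forall>j\<le>K. \<forall>x. \<bar>bump L j x\<bar> \<le> B"
proof -
  have "\<exists>B. \<forall>x. \<bar>bump L j x\<bar> \<le> B" for j
  proof -
    have "compact (poly ((pderiv ^^ j) (([:0, 1:] * [:1, -1:]) ^ L)) ` {0..1::real})"
      by (intro compact_continuous_image continuous_intros) auto
    then obtain B where B: "\<And>x. x \<in> {0..1::real} \<Longrightarrow>
        \<bar>poly ((pderiv ^^ j) (([:0, 1:] * [:1, -1:]) ^ L)) x\<bar> \<le> B"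
      by (meson bounded_real compact_imp_bounded imageI)
    have "0 \<le> B" using B[of 0] by auto
    then show ?thesis using B by (auto simp: bump_def intro!: exI[of _ B])
  qed
  then obtain b where b: "\<And>j x. \<bar>bump L j x\<bar> \<le> b j" by metis
  have b0: "0 \<le> b j" for j using b[of j 0] by (meson abs_ge_zero order_trans)
  have "\<bar>bump L j x\<bar> \<le> 1 + sum b {..K}" if "j \<le> K" for j x
    using b[of j x] member_le_sum[of j "{..K}" b, OF _ b0] that by simp
  moreover have "1 \<le> 1 + sum b {..K}" using b0 by (simp add: sum_nonneg)
  ultimately show ?thesis by blast
qed

lemma bump_0:
  "bump L 0 x = (if 0 < x \<and> x < 1 then (x * (1 - x)) ^ L else 0)"
  by (simp add: bump_def poly_power)

text \<open>A row of bumps on the unit intervals, with independent weights. Up to a constant factor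
  it is what \<open>mbump\<close> looks like along a line parallel to an axis.\<close>

definition pbump :: "nat \<Rightarrow> (int \<Rightarrow> real) \<Rightarrow> nat \<Rightarrow> real \<Rightarrow> real" where
  "pbump L w j x = w \<lfloor>x\<rfloor> * bump L j (frac x)"

lemma pbump_deriv:
  assumes "Suc j < L"
  shows "(pbump L w j has_real_derivative pbump L w (Suc j) x) (at x)"
proof -
  define n where "n = \<lfloor>x\<rfloor>"
  \<comment> \<open>Near x only the intervals starting at n - 1 and n matter. Since
    \<open>bump\<close> vanishes outside (0, 1), they can be written as a plain sum of two shifted
    bumps, which is differentiable even when x is an integer.\<close>
  let ?g = "\<lambda>j y. w n * bump L j (y - of_int n) + w (n - 1) * bump L j (y - of_int n + 1)"
  have eq: "?g j y = pbump L w j y" if "y \<in> {of_int n - 1<..<of_int n + 1}" for y j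
  proof (cases "y < of_int n")
    case True
    then have "\<lfloor>y\<rfloor> = n - 1" using that by (auto simp: floor_eq_iff)
    moreover have "frac y = y - of_int n + 1" using \<open>\<lfloor>y\<rfloor> = n - 1\<close> by (simp add: frac_def)
    ultimately show ?thesis using True by (simp add: pbump_def bump_def)
  next
    case False
    then have "\<lfloor>y\<rfloor> = n" using that by (auto simp: floor_eq_iff)
    moreover have "frac y = y - of_int n" using \<open>\<lfloor>y\<rfloor> = n\<close> by (simp add: frac_def)
    ultimately show ?thesis using False by (simp add: pbump_def bump_def)
  qed
  have x: "x \<in> {of_int n - 1<..<of_int n + 1}" unfolding n_def by (auto simp: less_eq_real_def) linarith+
  have "(?g j has_real_derivative
      w n * (bump L (Suc j) (x - of_int n) * 1) + w (n - 1) * (bump L (Suc j) (x - of_int n + 1) * 1)) (at x)"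
    by (intro DERIV_add DERIV_cmult DERIV_chain2[OF bump_deriv[OF assms]]) (auto intro!: derivative_eq_intros)
  then have "(?g j has_real_derivative pbump L w (Suc j) x) (at x)"
    using eq[OF x, of "Suc j"] by simp
  then show ?thesis
    by (rule has_field_derivative_transform_within_open[OF _ _ x]) (use eq in auto)
qed

text \<open>Only derivatives along the axes are given, so y is joined to x one coordinate at a time,
  with the mean value bound on each leg; no leg is longer than
  \<open>infnorm (x - y)\<close>.\<close>

lemma lipschitz_of_bounded_partials:
  fixes F :: "real ^ 'm::finite \<Rightarrow> real"
  assumes D: "\<And>x i. ((\<lambda>t. F (x + t *\<^sub>R axis i 1)) has_real_derivative G i x) (at 0)"
    and B: "\<And>x i. \<bar>G i x\<bar> \<le> B"
  shows "\<bar>F x - F y\<bar> \<le> real CARD('m) * B * infnorm (x - y)"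
proof -
  have B0: "0 \<le> B" using B[of undefined undefined] by linarith
  have step: "\<bar>F (z + s *\<^sub>R axis i 1) - F z\<bar> \<le> B * \<bar>s\<bar>" for z i s
  proof -
    have "((\<lambda>t. F (z + t *\<^sub>R axis i 1)) has_real_derivative G i (z + t *\<^sub>R axis i 1)) (at t)" for t
    proof -
      have "((\<lambda>h. F (z + t *\<^sub>R axis i 1 + h *\<^sub>R axis i 1)) has_real_derivative
          G i (z + t *\<^sub>R axis i 1)) (at 0)"
        by (rule D)
      then show ?thesis
        unfolding DERIV_def by (simp only: scaleR_add_left add.assoc add_0_right scaleR_zero_left add_0_left)
    qed
    then have "norm (F (z + s *\<^sub>R axis i 1) - F (z + 0 *\<^sub>R axis i 1)) \<le> B * norm (s - 0)"
      using B by (intro field_differentiable_bound[of UNIV "\<lambda>t. F (z + t *\<^sub>R axis i 1)"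
          "\<lambda>t. G i (z + t *\<^sub>R axis i 1)"]) auto
    then show ?thesis by simp
  qed
  have tel: "\<bar>F (y + (\<Sum>i\<in>S. (x $ i - y $ i) *\<^sub>R axis i 1)) - F y\<bar> \<le> (\<Sum>i\<in>S. B * \<bar>x $ i - y $ i\<bar>)"
    if "finite S" for S using that
  proof induction
    case (insert i S)
    have "F (y + (\<Sum>i\<in>insert i S. (x $ i - y $ i) *\<^sub>R axis i 1)) =
        F (y + (\<Sum>i\<in>S. (x $ i - y $ i) *\<^sub>R axis i 1) + (x $ i - y $ i) *\<^sub>R axis i 1)"
      using insert by (simp add: algebra_simps)
    then show ?case
      using insert step[of "y + (\<Sum>i\<in>S. (x $ i - y $ i) *\<^sub>R axis i 1)" "x $ i - y $ i" i] by simp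
  qed simp
  have "y + (\<Sum>i\<in>UNIV. (x $ i - y $ i) *\<^sub>R axis i 1) = x"
    using basis_expansion[of "x - y"] by (simp add: scalar_mult_eq_scaleR)
  then have "\<bar>F x - F y\<bar> \<le> (\<Sum>i\<in>UNIV. B * \<bar>x $ i - y $ i\<bar>)"
    using tel[of UNIV] by simp
  also have "\<dots> \<le> (\<Sum>i\<in>(UNIV::'m set). B * infnorm (x - y))"
    using component_le_infnorm_cart[of "x - y"] B0 by (intro sum_mono mult_left_mono) auto
  finally show ?thesis by simp
qed

section \<open>Hoelder norm of a rescaled family of bumps\<close>

lemma strict_floor_bounds:
  assumes "\<beta> > 0"
  shows "real (strict_floor \<beta>) < \<beta>" "\<beta> \<le> real (strict_floor \<beta>) + 1"
proof -
  have "real (strict_floor \<beta>) = of_int \<lceil>\<beta>\<rceil> - 1" using assms by (simp add: strict_floor_def)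
  then show "real (strict_floor \<beta>) < \<beta>" "\<beta> \<le> real (strict_floor \<beta>) + 1"
    using ceiling_correct[of \<beta>] by auto
qed

lemma holder_norm_le:
  fixes D :: "('m::finite \<Rightarrow> nat) \<Rightarrow> real ^ 'm \<Rightarrow> real"
  assumes "0 \<le> S" "0 \<le> R"
    and "\<And>\<alpha> x. real (sum \<alpha> UNIV) < \<beta> \<Longrightarrow> \<bar>D \<alpha> x\<bar> \<le> S"
    and "\<And>\<alpha> x y. sum \<alpha> UNIV = strict_floor \<beta> \<Longrightarrow>
      \<bar>D \<alpha> x - D \<alpha> y\<bar> \<le> R * infnorm (x - y) powr (\<beta> - real (strict_floor \<beta>))"
  shows "holder_norm \<beta> D \<le> ennreal (
    real (card {\<alpha>::'m \<Rightarrow> nat. real (sum \<alpha> UNIV) < \<beta>}) * S +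
    real (card {\<alpha>::'m \<Rightarrow> nat. sum \<alpha> UNIV = strict_floor \<beta>}) * R)"
proof -
  have "(\<Sum>\<alpha> \<in> {\<alpha>. real (sum \<alpha> UNIV) < \<beta>}. SUP x. ennreal \<bar>D \<alpha> x\<bar>) \<le>
      of_nat (card {\<alpha>::'m \<Rightarrow> nat. real (sum \<alpha> UNIV) < \<beta>}) * ennreal S"
    using assms(3) by (intro sum_bounded_above SUP_least ennreal_leI) auto
  moreover have "(\<Sum>\<alpha> \<in> {\<alpha>. sum \<alpha> UNIV = strict_floor \<beta>}.
        SUP (x, y) \<in> {(x, y). x \<noteq> y}.
          ennreal (\<bar>D \<alpha> x - D \<alpha> y\<bar> / infnorm (x - y) powr (\<beta> - real (strict_floor \<beta>)))) \<le>
      of_nat (card {\<alpha>::'m \<Rightarrow> nat. sum \<alpha> UNIV = strict_floor \<beta>}) * ennreal R"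
  proof (intro sum_bounded_above SUP_least)
    fix \<alpha> :: "'m \<Rightarrow> nat" and z :: "(real ^ 'm) \<times> (real ^ 'm)"
    assume \<alpha>: "\<alpha> \<in> {\<alpha>. sum \<alpha> UNIV = strict_floor \<beta>}" and z: "z \<in> {(x, y). x \<noteq> y}"
    obtain x y where xy: "z = (x, y)" "x \<noteq> y" using z by auto
    have "0 < infnorm (x - y)" using xy by (simp add: infnorm_pos_lt)
    then have "\<bar>D \<alpha> x - D \<alpha> y\<bar> / infnorm (x - y) powr (\<beta> - real (strict_floor \<beta>)) \<le> R"
      using assms(4)[of \<alpha> x y] \<alpha> by (simp add: divide_le_eq)
    then show "(case z of (x, y) \<Rightarrow> ennreal (\<bar>D \<alpha> x - D \<alpha> y\<bar> /
        infnorm (x - y) powr (\<beta> - real (strict_floor \<beta>)))) \<le> ennreal R"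
      using xy by (simp add: ennreal_leI)
  qed
  ultimately show ?thesis
    unfolding holder_norm_def using assms(1,2)
    by (simp add: ennreal_plus ennreal_mult ennreal_of_nat_eq_real_of_nat add_mono)
qed

text \<open>A tensor-product bump on every integer cell, weighted by \<open>w\<close>; \<alpha> is
  the order of the partial derivative. The jumps of \<open>w\<close> between cells do no harm
  because the bumps vanish on the faces.\<close>

definition mbump ::
    "nat \<Rightarrow> (('m::finite \<Rightarrow> int) \<Rightarrow> real) \<Rightarrow> ('m \<Rightarrow> nat) \<Rightarrow> real ^ 'm \<Rightarrow> real" where
  "mbump L w \<alpha> u = w (\<lambda>i. \<lfloor>u $ i\<rfloor>) * (\<Prod>i\<in>UNIV. bump L (\<alpha> i) (frac (u $ i)))"

text \<open>Along an axis the other coordinates are frozen: the weights restrict to a sequence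
  \<open>w'\<close> and the remaining factors to a constant \<open>P\<close>, which reduces the
  claim to \<open>pbump_deriv\<close>.\<close>

lemma mbump_deriv:
  assumes "Suc (sum \<alpha> UNIV) < L"
  shows "((\<lambda>t. mbump L w \<alpha> (u + t *\<^sub>R axis i 1)) has_real_derivative
    mbump L w (\<alpha>(i := Suc (\<alpha> i))) u) (at 0)"
proof -
  define w' where "w' n = w ((\<lambda>i. \<lfloor>u $ i\<rfloor>)(i := n))" for n
  define P where "P = (\<Prod>k\<in>UNIV - {i}. bump L (\<alpha> k) (frac (u $ k)))"
  have 1: "mbump L w \<alpha> (u + t *\<^sub>R axis i 1) = pbump L w' (\<alpha> i) (t + u $ i) * P" for t
  proof -
    have "(\<lambda>k. \<lfloor>(u + t *\<^sub>R axis i 1) $ k\<rfloor>) = (\<lambda>i. \<lfloor>u $ i\<rfloor>)(i := \<lfloor>t + u $ i\<rfloor>)"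
      by (auto simp: fun_eq_iff axis_def add.commute)
    moreover have "(\<Prod>k\<in>UNIV. bump L (\<alpha> k) (frac ((u + t *\<^sub>R axis i 1) $ k))) =
        bump L (\<alpha> i) (frac (t + u $ i)) * P"
      unfolding P_def by (subst prod.remove[of _ i]) (auto simp: axis_def add.commute intro!: prod.cong)
    ultimately show ?thesis by (simp add: mbump_def pbump_def w'_def)
  qed
  have 2: "mbump L w (\<alpha>(i := Suc (\<alpha> i))) u = pbump L w' (Suc (\<alpha> i)) (0 + u $ i) * P"
  proof -
    have "(\<Prod>k\<in>UNIV. bump L ((\<alpha>(i := Suc (\<alpha> i))) k) (frac (u $ k))) = bump L (Suc (\<alpha> i)) (frac (u $ i)) * P"
      unfolding P_def by (subst prod.remove[of _ i]) (auto intro!: prod.cong)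
    then show ?thesis by (simp add: mbump_def pbump_def w'_def fun_upd_idem)
  qed
  have "\<alpha> i \<le> sum \<alpha> UNIV" by (intro member_le_sum) auto
  then have "Suc (\<alpha> i) < L" using assms by simp
  then have "((\<lambda>t. pbump L w' (\<alpha> i) (t + u $ i)) has_real_derivative pbump L w' (Suc (\<alpha> i)) (0 + u $ i)) (at 0)"
    using iffD1[OF DERIV_shift pbump_deriv] by blast
  then show ?thesis unfolding 1 2 by (rule DERIV_cmult_right)
qed

lemma sum_fun_upd_Suc: "sum (\<alpha>(i := Suc (\<alpha> i))) UNIV = Suc (sum \<alpha> (UNIV :: 'm::finite set))"
proof -
  have "(\<Sum>k\<in>UNIV - {i}. (\<alpha>(i := Suc (\<alpha> i))) k) = sum \<alpha> (UNIV - {i})" by (intro sum.cong) auto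
  then show ?thesis using sum.remove[of UNIV i "\<alpha>(i := Suc (\<alpha> i))"] sum.remove[of UNIV i \<alpha>] by simp
qed

lemma mbump_bounded:
  assumes "\<And>j x. j \<le> K \<Longrightarrow> \<bar>bump L j x\<bar> \<le> B" "\<And>j. \<bar>w j\<bar> \<le> 1" "sum \<alpha> UNIV \<le> K" "0 \<le> B"
  shows "\<bar>mbump L w \<alpha> (u :: real ^ 'm::finite)\<bar> \<le> B ^ CARD('m)"
proof -
  have "\<alpha> i \<le> K" for i using assms(3) member_le_sum[of i UNIV \<alpha>] by simp
  then have "(\<Prod>i\<in>UNIV. \<bar>bump L (\<alpha> i) (frac (u $ i))\<bar>) \<le> (\<Prod>i\<in>(UNIV::'m set). B)"
    using assms(1) by (intro prod_mono) auto
  then have "\<bar>w (\<lambda>i. \<lfloor>u $ i\<rfloor>)\<bar> * (\<Prod>i\<in>UNIV. \<bar>bump L (\<alpha> i) (frac (u $ i))\<bar>) \<le> 1 * B ^ CARD('m)"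
    using assms(2,4) by (intro mult_mono) (auto intro: prod_nonneg)
  then show ?thesis by (simp add: mbump_def abs_mult abs_prod)
qed

definition cell :: "nat \<Rightarrow> real ^ 'm \<Rightarrow> 'm::finite \<Rightarrow> int" where
  "cell M x = (\<lambda>i. \<lfloor>real M * x $ i\<rfloor>)"

text \<open>With width 1/M and height M^(-\<beta>), a derivative of order k carries the factor M^(k
  - \<beta>), at most 1 for k < \<beta>, and the Hoelder quotient of top order is invariant under
  this scaling. Hence the condition on \<Lambda> does not involve M.\<close>

lemma mbump_family_in_holder_ball:
  fixes w :: "('m::finite \<Rightarrow> int) \<Rightarrow> real"
  assumes "0 < \<beta>" "strict_floor \<beta> + 2 < L" "1 \<le> M" "1 \<le> B" "0 < \<rho>"
    and B: "\<And>j x. j \<le> Suc (strict_floor \<beta>) \<Longrightarrow> \<bar>bump L j x\<bar> \<le> B"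
    and w: "\<And>j. \<bar>w j\<bar> \<le> 1"
    and \<Lambda>: "real (card {\<alpha>::'m \<Rightarrow> nat. real (sum \<alpha> UNIV) < \<beta>}) * (\<rho> * (1 + B ^ CARD('m))) +
      real (card {\<alpha>::'m \<Rightarrow> nat. sum \<alpha> UNIV = strict_floor \<beta>}) *
        (\<rho> * ((2 + real CARD('m)) * B ^ CARD('m))) \<le> \<Lambda>"
  defines "f \<equiv> (\<lambda>x. \<rho> + \<rho> * real M powr - \<beta> * mbump L w (\<lambda>_. 0) (real M *\<^sub>R x))"
  shows "f \<in> holder_ball \<beta> \<Lambda>" "continuous_on UNIV f"
proof -
  let ?k = "strict_floor \<beta>" and ?A = "B ^ CARD('m)"
  define D where "D \<alpha> x = (if \<alpha> = (\<lambda>_. 0) then \<rho> else 0) +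
    \<rho> * real M powr (real (sum \<alpha> UNIV) - \<beta>) * mbump L w \<alpha> (real M *\<^sub>R x)"
    for \<alpha> :: "'m \<Rightarrow> nat" and x :: "real ^ 'm"
  note k = strict_floor_bounds[OF \<open>0 < \<beta>\<close>]
  have A: "1 \<le> ?A" using assms(4) by simp
  have mb: "\<bar>mbump L w \<alpha> u\<bar> \<le> ?A" if "sum \<alpha> UNIV \<le> Suc ?k" for \<alpha> and u :: "real ^ 'm"
    using B w that assms(4) by (intro mbump_bounded[where K = "Suc ?k"]) auto
  have lip: "\<bar>mbump L w \<alpha> u - mbump L w \<alpha> v\<bar> \<le> real CARD('m) * ?A * infnorm (u - v)"
    if "sum \<alpha> UNIV \<le> ?k" for \<alpha> and u v :: "real ^ 'm"
  proof (rule lipschitz_of_bounded_partials)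
    show "((\<lambda>t. mbump L w \<alpha> (x + t *\<^sub>R axis i 1)) has_real_derivative
        mbump L w (\<alpha>(i := Suc (\<alpha> i))) x) (at 0)" for x i
      using that assms(2) by (intro mbump_deriv) auto
    show "\<bar>mbump L w (\<alpha>(i := Suc (\<alpha> i))) x\<bar> \<le> ?A" for x i
      using that by (intro mb) (simp only: sum_fun_upd_Suc)
  qed
  have "partials ?k f D"
    unfolding partials_def
  proof (intro conjI allI impI)
    show "D (\<lambda>_. 0) = f" by (simp add: D_def f_def fun_eq_iff)
    fix \<alpha> :: "'m \<Rightarrow> nat" and i x assume \<alpha>: "sum \<alpha> UNIV < ?k"
    have 1: "sum (\<alpha>(i := Suc (\<alpha> i))) UNIV = Suc (sum \<alpha> UNIV)"
      by (rule sum_fun_upd_Suc)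
    have 2: "\<alpha>(i := Suc (\<alpha> i)) \<noteq> (\<lambda>_. 0)" by (auto simp: fun_eq_iff)
    have "((\<lambda>s. mbump L w \<alpha> (real M *\<^sub>R x + s *\<^sub>R axis i 1)) has_real_derivative
        mbump L w (\<alpha>(i := Suc (\<alpha> i))) (real M *\<^sub>R x)) (at (real M * 0))"
      using \<alpha> assms(2) by (simp add: mbump_deriv)
    then have "((\<lambda>t. mbump L w \<alpha> (real M *\<^sub>R x + (real M * t) *\<^sub>R axis i 1)) has_real_derivative
        mbump L w (\<alpha>(i := Suc (\<alpha> i))) (real M *\<^sub>R x) * real M) (at 0)"
      by (rule DERIV_chain2) (auto intro!: derivative_eq_intros)
    then have "((\<lambda>t. D \<alpha> (x + t *\<^sub>R axis i 1)) has_real_derivative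
        0 + \<rho> * real M powr (real (sum \<alpha> UNIV) - \<beta>) *
          (mbump L w (\<alpha>(i := Suc (\<alpha> i))) (real M *\<^sub>R x) * real M)) (at 0)"
      unfolding D_def scaleR_add_right scaleR_scaleR by (intro DERIV_add DERIV_cmult) auto
    moreover have "real M powr (real (Suc (sum \<alpha> UNIV)) - \<beta>) = real M powr (real (sum \<alpha> UNIV) - \<beta>) * real M"
      using assms(3) powr_mult_base[of "real M" "real (sum \<alpha> UNIV) - \<beta>"] by (simp add: algebra_simps)
    ultimately show "((\<lambda>t. D \<alpha> (x + t *\<^sub>R axis i 1)) has_real_derivative D (\<alpha>(i := Suc (\<alpha> i))) x) (at 0)"
      unfolding D_def[of "\<alpha>(i := Suc (\<alpha> i))"] 1 using 2 by (simp add: mult_ac)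
  qed
  moreover have "holder_norm \<beta> D \<le> ennreal \<Lambda>"
  proof (rule order_trans[OF holder_norm_le ennreal_leI[OF \<Lambda>]])
    show "0 \<le> \<rho> * (1 + ?A)" "0 \<le> \<rho> * ((2 + real CARD('m)) * ?A)" using assms(5) A by auto
    fix \<alpha> :: "'m \<Rightarrow> nat" and x :: "real ^ 'm" assume \<alpha>: "real (sum \<alpha> UNIV) < \<beta>"
    then have "sum \<alpha> UNIV \<le> ?k" using k by linarith
    moreover have "real M powr (real (sum \<alpha> UNIV) - \<beta>) \<le> real M powr 0"
      using \<alpha> assms(3) by (intro powr_mono) auto
    then have "real M powr (real (sum \<alpha> UNIV) - \<beta>) \<le> 1" using assms(3) by simp
    ultimately have "real M powr (real (sum \<alpha> UNIV) - \<beta>) * \<bar>mbump L w \<alpha> (real M *\<^sub>R x)\<bar> \<le> 1 * ?A"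
      using mb[of \<alpha> "real M *\<^sub>R x"] by (intro mult_mono) auto
    then have "\<rho> * (real M powr (real (sum \<alpha> UNIV) - \<beta>) * \<bar>mbump L w \<alpha> (real M *\<^sub>R x)\<bar>) \<le> \<rho> * ?A"
      using assms(5) by (intro mult_left_mono) auto
    then have "\<bar>\<rho> * real M powr (real (sum \<alpha> UNIV) - \<beta>) * mbump L w \<alpha> (real M *\<^sub>R x)\<bar> \<le> \<rho> * ?A"
      using assms(5) by (simp add: abs_mult mult.assoc)
    moreover have "\<bar>if \<alpha> = (\<lambda>_. 0) then \<rho> else 0\<bar> \<le> \<rho>" using assms(5) by auto
    ultimately show "\<bar>D \<alpha> x\<bar> \<le> \<rho> * (1 + ?A)"
      unfolding D_def by (simp only: distrib_left mult_1_right)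
  next
    fix \<alpha> :: "'m \<Rightarrow> nat" and x y :: "real ^ 'm" assume \<alpha>: "sum \<alpha> UNIV = ?k"
    define \<gamma> where "\<gamma> = \<beta> - real ?k"
    define s where "s = infnorm (real M *\<^sub>R x - real M *\<^sub>R y)"
    have \<gamma>: "0 < \<gamma>" "\<gamma> \<le> 1" using k by (auto simp: \<gamma>_def)
    have s0: "0 \<le> s" by (simp add: s_def infnorm_pos_le)
    have s: "s = real M * infnorm (x - y)"
      unfolding s_def by (simp flip: scaleR_diff_right add: infnorm_mul)
    have "\<bar>mbump L w \<alpha> (real M *\<^sub>R x) - mbump L w \<alpha> (real M *\<^sub>R y)\<bar> \<le> (2 + real CARD('m)) * ?A * s powr \<gamma>"
    \<comment> \<open>In rescaled coordinates, points at distance at least 1 are handled by the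
      supremum bound, closer ones by the Lipschitz bound and s \<le> s^\<gamma>.\<close>
    proof (cases "1 \<le> s")
      case True
      have "\<bar>mbump L w \<alpha> (real M *\<^sub>R x) - mbump L w \<alpha> (real M *\<^sub>R y)\<bar> \<le> 2 * ?A"
        using mb[of \<alpha> "real M *\<^sub>R x"] mb[of \<alpha> "real M *\<^sub>R y"] \<alpha> by simp
      also have "\<dots> \<le> (2 + real CARD('m)) * ?A * 1" using A by (simp add: algebra_simps)
      also have "\<dots> \<le> (2 + real CARD('m)) * ?A * s powr \<gamma>"
        using True \<gamma> A by (intro mult_left_mono ge_one_powr_ge_zero) auto
      finally show ?thesis .
    next
      case False
      have "s \<le> s powr \<gamma>"
      proof (cases "s = 0")
        case False
        then show ?thesis using powr_mono'[of \<gamma> 1 s] \<gamma> s0 \<open>\<not> 1 \<le> s\<close> by simp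
      qed simp
      have "\<bar>mbump L w \<alpha> (real M *\<^sub>R x) - mbump L w \<alpha> (real M *\<^sub>R y)\<bar> \<le> real CARD('m) * ?A * s"
        unfolding s_def using \<alpha> by (intro lip) simp
      also have "\<dots> \<le> (2 + real CARD('m)) * ?A * s powr \<gamma>"
        using \<open>s \<le> s powr \<gamma>\<close> A s0 by (intro mult_mono) auto
      finally show ?thesis .
    qed
    moreover have "s powr \<gamma> = real M powr \<gamma> * infnorm (x - y) powr \<gamma>"
      unfolding s by (rule powr_mult)
    ultimately have *: "\<bar>mbump L w \<alpha> (real M *\<^sub>R x) - mbump L w \<alpha> (real M *\<^sub>R y)\<bar> \<le>
        (2 + real CARD('m)) * ?A * (real M powr \<gamma> * infnorm (x - y) powr \<gamma>)" by simp
    have "D \<alpha> x - D \<alpha> y = \<rho> * real M powr - \<gamma> * (mbump L w \<alpha> (real M *\<^sub>R x) - mbump L w \<alpha> (real M *\<^sub>R y))"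
      by (simp add: D_def \<alpha> \<gamma>_def algebra_simps)
    then have "\<bar>D \<alpha> x - D \<alpha> y\<bar> =
        \<rho> * real M powr - \<gamma> * \<bar>mbump L w \<alpha> (real M *\<^sub>R x) - mbump L w \<alpha> (real M *\<^sub>R y)\<bar>"
      using assms(5) by (simp add: abs_mult)
    also have "\<dots> \<le> \<rho> * real M powr - \<gamma> *
        ((2 + real CARD('m)) * ?A * (real M powr \<gamma> * infnorm (x - y) powr \<gamma>))"
      using assms(5) * by (intro mult_left_mono) auto
    also have "\<dots> = \<rho> * ((2 + real CARD('m)) * ?A) * (real M powr - \<gamma> * real M powr \<gamma>) * infnorm (x - y) powr \<gamma>"
      by (simp only: mult_ac)
    also have "real M powr - \<gamma> * real M powr \<gamma> = 1"
      using assms(3) by (simp flip: powr_add)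
    finally show "\<bar>D \<alpha> x - D \<alpha> y\<bar> \<le> \<rho> * ((2 + real CARD('m)) * ?A) * infnorm (x - y) powr (\<beta> - real ?k)"
      by (simp add: \<gamma>_def)
  qed
  ultimately show "f \<in> holder_ball \<beta> \<Lambda>" unfolding holder_ball_def by blast
  have "(real CARD('m) * ?A)-lipschitz_on UNIV (mbump L w (\<lambda>_. 0))"
  proof (rule lipschitz_onI)
    fix u v :: "real ^ 'm"
    have "real CARD('m) * ?A * infnorm (u - v) \<le> real CARD('m) * ?A * norm (u - v)"
      using A by (intro mult_left_mono infnorm_le_norm) auto
    then show "dist (mbump L w (\<lambda>_. 0) u) (mbump L w (\<lambda>_. 0) v) \<le> real CARD('m) * ?A * dist u v"
      using lip[of "\<lambda>_. 0" u v] unfolding dist_norm real_norm_def by (simp only: sum.neutral_const) linarith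
  qed (use A in auto)
  then have "continuous_on UNIV (mbump L w (\<lambda>_. 0))" by (rule lipschitz_on_continuous_on)
  then have "continuous_on UNIV (\<lambda>x. mbump L w (\<lambda>_. 0) (real M *\<^sub>R x))"
    by (rule continuous_on_compose2) (auto intro: continuous_on_scaleR continuous_on_const continuous_on_id)
  then show "continuous_on UNIV f"
    unfolding f_def by (intro continuous_on_add continuous_on_mult continuous_on_const)
qed

lemma holder_bumps:
  assumes "\<beta> > 0" "\<Lambda> > 0"
  obtains a c \<rho> :: real and g :: "nat \<Rightarrow> real ^ 'm::finite \<Rightarrow> real" where
    "0 < a" "0 < c" "0 < \<rho>" "a + \<rho> \<le> 1 / 2"
    "\<And>M x. 0 \<le> g M x \<and> g M x \<le> \<rho> * real M powr - \<beta>"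
    "\<And>M x. (\<And>i. frac (real M * x $ i) \<in> {1/4..3/4}) \<Longrightarrow> c * real M powr - \<beta> \<le> g M x"
    "\<And>M. g M 0 = 0"
    "\<And>M W. 1 \<le> M \<Longrightarrow> (\<lambda>x. a + (if cell M x \<in> W then g M x else 0)) \<in> holder_ball \<beta> \<Lambda>"
    "\<And>M W. 1 \<le> M \<Longrightarrow> continuous_on UNIV (\<lambda>x. a + (if cell M x \<in> W then g M x else 0))"
proof -
  \<comment> \<open>The derivatives of top order are differentiated once more to obtain their
    Lipschitz bound, so L has to exceed \<open>strict_floor \<beta> + 1\<close>.\<close>
  define L where "L = strict_floor \<beta> + 3"
  obtain B where B: "1 \<le> B" "\<And>j x. j \<le> Suc (strict_floor \<beta>) \<Longrightarrow> \<bar>bump L j x\<bar> \<le> B"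
    using bump_bounded by blast
  define T where "T = real (card {\<alpha>::'m \<Rightarrow> nat. real (sum \<alpha> UNIV) < \<beta>}) * (1 + B ^ CARD('m)) +
      real (card {\<alpha>::'m \<Rightarrow> nat. sum \<alpha> UNIV = strict_floor \<beta>}) * ((2 + real CARD('m)) * B ^ CARD('m))"
  have T: "0 \<le> T" unfolding T_def using B(1) by (intro add_nonneg_nonneg mult_nonneg_nonneg) auto
  \<comment> \<open>\<open>T\<close> is the norm bound at \<rho> = 1, and the bound is linear in
    \<rho>. The cap 1/4 keeps base plus bump, together 2 \<rho>, at most 1/2.\<close>
  define \<rho> where "\<rho> = min (1 / 4) (\<Lambda> / (1 + T))"
  have \<rho>: "0 < \<rho>" "\<rho> \<le> 1 / 4" using T assms unfolding \<rho>_def by (simp, intro min.cobounded1)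
  have "\<rho> * T \<le> \<Lambda> / (1 + T) * T" using T by (intro mult_right_mono) (auto simp: \<rho>_def)
  also have "\<dots> \<le> \<Lambda>" using T assms by (simp add: field_simps)
  finally have \<rho>T: "\<rho> * T \<le> \<Lambda>" .
  have \<rho>T': "real (card {\<alpha>::'m \<Rightarrow> nat. real (sum \<alpha> UNIV) < \<beta>}) * (\<rho> * (1 + B ^ CARD('m))) +
      real (card {\<alpha>::'m \<Rightarrow> nat. sum \<alpha> UNIV = strict_floor \<beta>}) *
        (\<rho> * ((2 + real CARD('m)) * B ^ CARD('m))) \<le> \<Lambda>"
    using \<rho>T unfolding T_def distrib_left by (simp only: mult_ac)
  define w where "w W j = (if j \<in> W then 1 else 0 :: real)" for W :: "('m \<Rightarrow> int) set" and j
  define P where "P u = (\<Prod>i\<in>UNIV. bump L 0 (frac (u $ i)))" for u :: "real ^ 'm"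
  define g where "g M x = \<rho> * real M powr - \<beta> * P (real M *\<^sub>R x)" for M x
  have b01: "0 \<le> bump L 0 x" "bump L 0 x \<le> 1" for x
    by (auto simp: bump_0 intro!: power_le_one mult_le_one)
  have P01: "0 \<le> P u" "P u \<le> 1" for u
    unfolding P_def using b01 by (auto intro!: prod_nonneg prod_le_1)
  show ?thesis
  proof
    \<comment> \<open>The base height \<open>a\<close> is \<rho> as well. The constant
      \<open>c\<close> collects one factor (3/16)^L per coordinate, the minimum of (t (1 - t))^L on
      the middle half [1/4, 3/4].\<close>
    show "0 < \<rho>" "0 < \<rho> * ((3 / 16) ^ L) ^ CARD('m)" "0 < \<rho>" "\<rho> + \<rho> \<le> 1 / 2" using \<rho> by auto
    show "0 \<le> g M x \<and> g M x \<le> \<rho> * real M powr - \<beta>" for M x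
      using P01[of "real M *\<^sub>R x"] \<rho> unfolding g_def by (auto intro!: mult_left_le)
    show "\<rho> * ((3 / 16) ^ L) ^ CARD('m) * real M powr - \<beta> \<le> g M x"
      if *: "\<And>i. frac (real M * x $ i) \<in> {1/4..3/4}" for M x
    proof -
      have "(3 / 16) ^ L \<le> bump L 0 (frac (real M * x $ i))" for i
      proof -
        define t where "t = frac (real M * x $ i)"
        have t: "1 / 4 \<le> t" "t \<le> 3 / 4" using *[of i] by (auto simp: t_def)
        then have "0 \<le> (t - 1 / 4) * (3 / 4 - t)" by simp
        moreover have "(t - 1 / 4) * (3 / 4 - t) = t * (1 - t) - 3 / 16" by (simp add: field_simps)
        ultimately have "3 / 16 \<le> t * (1 - t)" by simp
        then show ?thesis using t by (simp add: bump_0 power_mono flip: t_def)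
      qed
      then have "(\<Prod>i\<in>(UNIV::'m set). (3 / 16) ^ L) \<le> P (real M *\<^sub>R x)"
        unfolding P_def by (intro prod_mono) auto
      then have "((3 / 16) ^ L) ^ CARD('m) * (\<rho> * real M powr - \<beta>) \<le> P (real M *\<^sub>R x) * (\<rho> * real M powr - \<beta>)"
        using \<rho> by (intro mult_right_mono) auto
      then show ?thesis by (simp add: g_def mult_ac)
    qed
    show "g M 0 = 0" for M by (simp add: g_def P_def bump_0)
    fix M :: nat and W :: "('m \<Rightarrow> int) set" assume M: "1 \<le> M"
    have eq: "(\<lambda>x. \<rho> + (if cell M x \<in> W then g M x else 0)) =
      (\<lambda>x. \<rho> + \<rho> * real M powr - \<beta> * mbump L (w W) (\<lambda>_. 0) (real M *\<^sub>R x))"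
      by (auto simp: fun_eq_iff g_def mbump_def P_def w_def cell_def)
    show "(\<lambda>x. \<rho> + (if cell M x \<in> W then g M x else 0)) \<in> holder_ball \<beta> \<Lambda>"
      "continuous_on UNIV (\<lambda>x. \<rho> + (if cell M x \<in> W then g M x else 0))"
      unfolding eq
      by (rule mbump_family_in_holder_ball[where B = B];
        use assms(1) M B \<rho> \<rho>T' in \<open>auto simp: L_def w_def\<close>)+
  qed
qed

section \<open>Boundary fragments with prescribed separation exponent\<close>

lemma unit_cube_eq: "(unit_cube :: 'm::finite point set) = cbox 0 1 \<times> {0..1}"
  by (auto simp: unit_cube_def mem_box_cart)

lemma emeasure_cbox_cart:
  fixes a b :: "real ^ 'm::finite"
  assumes "\<And>i. a $ i \<le> b $ i"
  shows "emeasure lborel (cbox a b) = ennreal (\<Prod>i\<in>UNIV. b $ i - a $ i)"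
proof -
  have "cbox a b \<noteq> {}" using assms by (simp add: interval_ne_empty_cart)
  then have "measure lborel (cbox a b) = (\<Prod>i\<in>UNIV. b $ i - a $ i)" by (rule content_cbox_cart)
  moreover have "emeasure lborel (cbox a b) = ennreal (measure lborel (cbox a b))"
    using emeasure_lborel_cbox_finite[of a b] by (intro emeasure_eq_ennreal_measure) auto
  ultimately show ?thesis by simp
qed

lemma emeasure_lborel_Times:
  fixes A :: "'a::euclidean_space set" and B :: "'b::euclidean_space set"
  assumes "A \<in> sets borel" "B \<in> sets borel"
  shows "emeasure lborel (A \<times> B) = emeasure lborel A * emeasure lborel B"
  using assms by (subst lborel_prod[symmetric]) (simp add: lborel.emeasure_pair_measure_Times)

lemma unit_cube_borel [measurable]: "unit_cube \<in> sets borel"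
  unfolding unit_cube_eq by (intro borel_closed closed_Times closed_cbox closed_atLeastAtMost)

lemma space_cube_measure [simp]: "space cube_measure = unit_cube"
  by (simp add: cube_measure_def space_restrict_space)

lemma emeasure_cube_measure:
  assumes "A \<subseteq> unit_cube" shows "emeasure cube_measure A = emeasure lborel A"
  using assms unfolding cube_measure_def by (intro emeasure_restrict_space) auto

lemma measurable_cube_measureI: "f \<in> measurable borel N \<Longrightarrow> f \<in> measurable cube_measure N"
  unfolding cube_measure_def by (rule measurable_restrict_space1) simp

lemma emeasure_unit_cube: "emeasure lborel (unit_cube :: 'm::finite point set) = 1"
  unfolding unit_cube_eq by (subst emeasure_lborel_Times) (auto simp: emeasure_cbox_cart)

lemma prob_space_cube: "prob_space (cube_measure :: 'm::finite point measure)"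
  by (rule prob_spaceI) (simp add: emeasure_cube_measure emeasure_unit_cube)

text \<open>Fubini by columns. Asking for mean zero only in almost every column is what leaves the
  column over \<open>0\<close> free.\<close>

lemma cube_integral_eq_0:
  fixes h :: "'m::finite point \<Rightarrow> real"
  assumes h [measurable]: "h \<in> borel_measurable borel"
    and B: "\<And>x. x \<in> unit_cube \<Longrightarrow> \<bar>h x\<bar> \<le> B"
    and col: "AE x in lborel. x \<in> cbox 0 1 \<longrightarrow> (\<integral>t. indicat_real {0..1} t * h (x, t) \<partial>lborel) = 0"
  shows "(\<integral>x. h x \<partial>cube_measure) = 0"
proof -
  let ?H = "\<lambda>z. indicat_real unit_cube z * h z"
  have "integrable lborel ?H"
  proof (rule Bochner_Integration.integrable_bound)
    show "integrable lborel (\<lambda>z::'m point. B * indicat_real unit_cube z)"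
      by (intro integrable_mult_right integrable_real_indicator) (auto simp: emeasure_unit_cube)
  qed (auto simp: indicator_def dest!: B)
  then have int: "integrable (lborel \<Otimes>\<^sub>M lborel) ?H" by (simp add: lborel_prod)
  have "(\<integral>x. h x \<partial>cube_measure) = (\<integral>z. ?H z \<partial>lborel)"
    unfolding cube_measure_def by (subst integral_restrict_space) auto
  also have "\<dots> = (\<integral>z. ?H z \<partial>(lborel \<Otimes>\<^sub>M lborel))" by (simp add: lborel_prod)
  also have "\<dots> = (\<integral>x. (\<integral>t. ?H (x, t) \<partial>lborel) \<partial>lborel)"
    by (rule lborel_pair.integral_fst'[OF int, symmetric])
  also have "\<dots> = (\<integral>x. 0 \<partial>(lborel :: (real ^ 'm) measure))"
  proof (rule integral_cong_AE)
    show "AE x in lborel. (\<integral>t. ?H (x, t) \<partial>lborel) = 0"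
      using col by eventually_elim (auto simp: unit_cube_eq indicator_times mult.assoc)
  qed auto
  finally show ?thesis by simp
qed

lemma column_integral_eq_0:
  assumes "0 \<le> v" "v \<le> 1"
  shows "(\<integral>t. indicat_real {0..1} t * (if t \<le> v then \<Delta> * (1 - v) else - (\<Delta> * v)) \<partial>lborel) = 0"
proof -
  have "(\<integral>t. indicat_real {0..1} t * (if t \<le> v then \<Delta> * (1 - v) else - (\<Delta> * v)) \<partial>lborel) =
    (\<integral>t. \<Delta> * (1 - v) * indicat_real {0..v} t - \<Delta> * v * indicat_real {v<..1} t \<partial>lborel)"
    using assms by (intro Bochner_Integration.integral_cong) (auto simp: indicator_def)
  also have "\<dots> = \<Delta> * (1 - v) * v - \<Delta> * v * (1 - v)"
    using assms by (subst Bochner_Integration.integral_diff) auto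
  finally show ?thesis by simp
qed

text \<open>This plays the part of (p - q) / 2. On the column over \<open>0\<close> the factor 1/2
  keeps the modulus at most 1/2 and makes the separation exactly \<bar>t\<bar>^(1/\<kappa>).\<close>

definition profile :: "real \<Rightarrow> real \<Rightarrow> (real ^ 'm \<Rightarrow> real) \<Rightarrow> 'm::finite point \<Rightarrow> real" where
  "profile \<kappa> \<Delta> f x =
     (if fst x = 0 then sgn (f 0 - snd x) * \<bar>snd x - f 0\<bar> powr (1 / \<kappa>) / 2
      else if snd x \<le> f (fst x) then \<Delta> * (1 - f (fst x)) else - (\<Delta> * f (fst x)))"

definition perturbed_pair ::
    "('m point \<Rightarrow> real) \<Rightarrow> ('m::finite point \<Rightarrow> real) \<times> ('m point \<Rightarrow> real)" where
  "perturbed_pair \<eta> = (\<lambda>x. 1 + \<eta> x, \<lambda>x. 1 - \<eta> x)"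

section \<open>The pair of densities attached to one boundary function\<close>

context
  fixes f :: "real ^ 'm::finite \<Rightarrow> real" and \<kappa> \<Delta> lo :: real
  assumes cont: "continuous_on UNIV f" and lo: "0 < lo" "\<And>x. lo \<le> f x" and hi: "\<And>x. f x \<le> 1 / 2"
    and \<Delta>: "0 < \<Delta>" "\<Delta> \<le> 1 / 2" and \<kappa>: "0 < \<kappa>"
begin

lemma frontier_bounds: "0 < f x" "f x < 1"
  using lo(1) lo(2)[of x] hi[of x] by auto

lemma profile_measurable: "profile \<kappa> \<Delta> f \<in> borel_measurable borel"
proof -
  have [measurable]: "f \<in> borel_measurable borel" using cont by (rule borel_measurable_continuous_onI)
  have "profile \<kappa> \<Delta> f \<in> borel_measurable (borel \<Otimes>\<^sub>M borel)"
    unfolding profile_def by measurable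
  then show ?thesis by (simp add: borel_prod)
qed

text \<open>It has to hold pointwise, on the frontier and on the column over \<open>0\<close> too:
  the Bayes region must equal the fragment as a set, not up to a null set.\<close>

lemma profile_nonneg_iff: "0 \<le> profile \<kappa> \<Delta> f x \<longleftrightarrow> snd x \<le> f (fst x)"
  using \<Delta> frontier_bounds[of "fst x"] by (auto simp: profile_def sgn_if mult_le_0_iff zero_le_mult_iff)

lemma profile_abs_le:
  assumes "x \<in> unit_cube" shows "\<bar>profile \<kappa> \<Delta> f x\<bar> \<le> 1 / 2"
proof (cases "fst x = 0")
  case True
  have "\<bar>snd x - f 0\<bar> \<le> 1" using assms frontier_bounds[of 0] by (auto simp: unit_cube_def)
  then have "\<bar>snd x - f 0\<bar> powr (1 / \<kappa>) \<le> 1 powr (1 / \<kappa>)"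
    using \<kappa> by (intro powr_mono2) auto
  then show ?thesis using True by (auto simp: profile_def abs_mult sgn_if)
next
  case False
  have "\<Delta> * (1 - f (fst x)) \<le> (1 / 2) * 1" "\<Delta> * f (fst x) \<le> (1 / 2) * 1"
    using \<Delta> frontier_bounds[of "fst x"] by (intro mult_mono; simp)+
  then show ?thesis using False \<Delta> frontier_bounds[of "fst x"] by (auto simp: profile_def abs_mult)
qed

lemma profile_integral: "(\<integral>x. profile \<kappa> \<Delta> f x \<partial>cube_measure) = 0"
proof (rule cube_integral_eq_0[OF profile_measurable profile_abs_le])
  have "AE x in lborel. x \<noteq> (0 :: real ^ 'm)"
    by (rule AE_lborel_singleton)
  then show "AE x in lborel. x \<in> cbox 0 1 \<longrightarrow>
      (\<integral>t. indicat_real {0..1} t * profile \<kappa> \<Delta> f (x, t) \<partial>lborel) = 0"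
  proof eventually_elim
    case (elim x)
    then have "profile \<kappa> \<Delta> f (x, t) = (if t \<le> f x then \<Delta> * (1 - f x) else - (\<Delta> * f x))" for t
      by (simp add: profile_def)
    then show ?case using column_integral_eq_0[of "f x" \<Delta>] frontier_bounds[of x] by simp
  qed
qed

lemma boundary_null: "boundary f \<in> null_sets lborel"
proof -
  have "boundary f = unit_cube \<inter> {x. f (fst x) = snd x}" by (auto simp: boundary_def)
  moreover have "closed {x. f (fst x) = snd x}"
    by (intro closed_Collect_eq continuous_on_compose2[OF cont] continuous_intros) auto
  ultimately have m: "boundary f \<in> sets borel" by auto
  then have m': "boundary f \<in> sets (lborel \<Otimes>\<^sub>M lborel)" by (simp only: lborel_prod sets_lborel)
  have "emeasure lborel (boundary f) = (\<integral>\<^sup>+ x. emeasure lborel (Pair x -` boundary f) \<partial>lborel)"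
    using lborel.emeasure_pair_measure_alt[OF m'] by (simp only: lborel_prod)
  also have "\<dots> = (\<integral>\<^sup>+ x. 0 \<partial>(lborel :: (real ^ 'm) measure))"
  proof (rule nn_integral_cong)
    fix x
    have "Pair x -` boundary f \<subseteq> {f x}" by (auto simp: boundary_def)
    then show "emeasure lborel (Pair x -` boundary f) = 0"
      by (metis emeasure_lborel_countable countable_finite finite.emptyI finite.insertI finite_subset)
  qed
  finally show ?thesis using m by (simp add: null_sets_def)
qed

text \<open>The frontier stays strictly between 0 and 1, so a boundary point is interior to its
  column and the limits defining the exponent are two-sided.\<close>

lemma at_within_column:
  assumes "x \<in> boundary f"
  shows "at 0 within {t. shift_last x t \<in> unit_cube} = at 0"
proof (rule at_within_interior, rule interiorI)
  let ?v = "f (fst x)"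
  show "open {- ?v<..<1 - ?v}" "0 \<in> {- ?v<..<1 - ?v}" using frontier_bounds[of "fst x"] by auto
  show "{- ?v<..<1 - ?v} \<subseteq> {t. shift_last x t \<in> unit_cube}"
    using assms by (auto simp: boundary_def unit_cube_def shift_last_def)
qed

abbreviation "dens_pos \<equiv> fst (perturbed_pair (profile \<kappa> \<Delta> f))"
abbreviation "dens_neg \<equiv> snd (perturbed_pair (profile \<kappa> \<Delta> f))"

lemma sep_profile: "t \<noteq> 0 \<Longrightarrow> sep dens_pos dens_neg x t = 2 * \<bar>profile \<kappa> \<Delta> f (shift_last x t)\<bar>"
  by (simp add: sep_def perturbed_pair_def)

lemma sep_zero_column:
  assumes "x \<in> boundary f" "fst x = 0" "t \<noteq> 0"
  shows "sep dens_pos dens_neg x t = \<bar>t\<bar> powr (1 / \<kappa>)"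
  using assms by (auto simp: sep_profile profile_def shift_last_def boundary_def abs_mult sgn_if)

text \<open>The heights are \<Delta> (1 - v) and \<Delta> v, and \<open>lo\<close> \<le> v \<le> 1/2
  bounds both v and 1 - v below by \<open>lo\<close>.\<close>

lemma sep_other_column:
  assumes "x \<in> boundary f" "fst x \<noteq> 0" "t \<noteq> 0"
  shows "2 * \<Delta> * lo \<le> sep dens_pos dens_neg x t" "sep dens_pos dens_neg x t \<le> 1"
proof -
  let ?v = "f (fst x)"
  have s: "sep dens_pos dens_neg x t = 2 * \<Delta> * (if t \<le> 0 then 1 - ?v else ?v)"
    using assms \<Delta> frontier_bounds[of "fst x"]
    by (auto simp: sep_profile profile_def shift_last_def boundary_def abs_mult)
  have b: "lo \<le> (if t \<le> 0 then 1 - ?v else ?v)" "(if t \<le> 0 then 1 - ?v else ?v) \<le> 1"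
    using lo(2)[of "fst x"] hi[of "fst x"] frontier_bounds[of "fst x"] by auto
  show "2 * \<Delta> * lo \<le> sep dens_pos dens_neg x t" unfolding s using b \<Delta> by (intro mult_left_mono) auto
  have "2 * \<Delta> * (if t \<le> 0 then 1 - ?v else ?v) \<le> 1 * 1" using b lo(1) \<Delta> by (intro mult_mono) auto
  then show "sep dens_pos dens_neg x t \<le> 1" unfolding s by simp
qed

text \<open>A separation bounded away from 0 beats every power of \<bar>t\<bar>: the quotient tends
  to \<infinity>, which counts as a positive limit, so every k > 0 is admissible.\<close>

lemma sep_exponent_other_column:
  assumes "x \<in> boundary f" "fst x \<noteq> 0"
  shows "sep_exponent dens_pos dens_neg x = \<infinity>"
proof -
  let ?K = "{ennreal k | k. k \<ge> 0 \<and>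
       (\<exists>L::ereal. L > 0 \<and>
         ((\<lambda>t. ereal (sep dens_pos dens_neg x t / \<bar>t\<bar> powr (1 / k))) \<longlongrightarrow> L)
           (at 0 within {t. shift_last x t \<in> unit_cube}))}"
  have K: "ennreal k \<in> ?K" if k: "0 < k" for k
  proof -
    have "LIM t at (0::real). 2 * \<Delta> * lo * (\<bar>t\<bar> powr - (1 / k)) :> at_top"
    proof (rule filterlim_tendsto_pos_mult_at_top[OF tendsto_const])
      show "0 < 2 * \<Delta> * lo" using \<Delta> lo by simp
      have "LIM t at (0::real). \<bar>t\<bar> :> at_right 0"
        by (auto simp: filterlim_at eventually_at_filter intro!: tendsto_eq_intros)
      moreover have "LIM s at_right (0::real). s powr - (1 / k) :> at_top"
        using k by real_asymp
      ultimately show "LIM t at (0::real). \<bar>t\<bar> powr - (1 / k) :> at_top"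
        by (rule filterlim_compose[rotated])
    qed
    then have "LIM t at (0::real). sep dens_pos dens_neg x t / \<bar>t\<bar> powr (1 / k) :> at_top"
    proof (rule filterlim_at_top_mono)
      show "\<forall>\<^sub>F t in at 0. 2 * \<Delta> * lo * (\<bar>t\<bar> powr - (1 / k)) \<le> sep dens_pos dens_neg x t / \<bar>t\<bar> powr (1 / k)"
        unfolding eventually_at_filter powr_minus_divide
        using sep_other_column(1)[OF assms] by (auto simp: divide_right_mono intro!: always_eventually)
    qed
    then have "((\<lambda>t. ereal (sep dens_pos dens_neg x t / \<bar>t\<bar> powr (1 / k))) \<longlongrightarrow> \<infinity>) (at 0)"
      by (simp add: tendsto_PInfty_eq_at_top)
    then show ?thesis using k unfolding at_within_column[OF assms(1)]
      by (auto intro!: exI[of _ k] exI[of _ \<infinity>])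
  qed
  have "of_nat n \<le> Sup ?K" for n :: nat
  proof -
    have "of_nat n \<le> ennreal (real n + 1)" by (simp flip: ennreal_of_nat_eq_real_of_nat add: ennreal_leI)
    also have "\<dots> \<le> Sup ?K" by (rule Sup_upper, rule K) simp
    finally show ?thesis .
  qed
  then have "\<not> Sup ?K < top" using ennreal_Ex_less_of_nat by (meson leD)
  then show ?thesis unfolding sep_exponent_def by (simp only: less_top[symmetric] infinity_ennreal_def not_not)
qed

text \<open>The quotient is \<bar>t\<bar>^(1/\<kappa> - 1/k), with limit 1 at k = \<kappa> and limit
  0 for every k > \<kappa>.\<close>

lemma sep_exponent_zero_column:
  assumes "x \<in> boundary f" "fst x = 0"
  shows "sep_exponent dens_pos dens_neg x = ennreal \<kappa>"
proof -
  have ev: "\<forall>\<^sub>F t in at 0. ereal (sep dens_pos dens_neg x t / \<bar>t\<bar> powr (1 / k)) = ereal (\<bar>t\<bar> powr (1 / \<kappa> - 1 / k))" for k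
    unfolding eventually_at_filter
    using sep_zero_column[OF assms] by (auto simp: powr_diff intro!: always_eventually)
  show ?thesis unfolding sep_exponent_def at_within_column[OF assms(1)]
  proof (rule antisym)
    have "((\<lambda>t. ereal (sep dens_pos dens_neg x t / \<bar>t\<bar> powr (1 / \<kappa>))) \<longlongrightarrow> ereal 1) (at 0)"
      by (subst tendsto_cong[OF ev]) (auto simp: eventually_at_filter intro!: tendsto_eventually)
    then show "ennreal \<kappa> \<le> Sup {ennreal k | k. k \<ge> 0 \<and> (\<exists>L::ereal. L > 0 \<and>
        ((\<lambda>t. ereal (sep dens_pos dens_neg x t / \<bar>t\<bar> powr (1 / k))) \<longlongrightarrow> L) (at 0))}"
      using \<kappa> by (intro Sup_upper) (auto intro!: exI[of _ \<kappa>] exI[of _ "ereal 1"] simp: one_ereal_def)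
    show "Sup {ennreal k | k. k \<ge> 0 \<and> (\<exists>L::ereal. L > 0 \<and>
        ((\<lambda>t. ereal (sep dens_pos dens_neg x t / \<bar>t\<bar> powr (1 / k))) \<longlongrightarrow> L) (at 0))} \<le> ennreal \<kappa>"
    proof (rule Sup_least, clarify)
      fix k L assume k: "0 \<le> k" and L: "(0::ereal) < L"
        and lim: "((\<lambda>t. ereal (sep dens_pos dens_neg x t / \<bar>t\<bar> powr (1 / k))) \<longlongrightarrow> L) (at 0)"
      have "k \<le> \<kappa>"
      proof (rule ccontr)
        assume "\<not> k \<le> \<kappa>"
        then have "0 < 1 / \<kappa> - 1 / k" using \<kappa> by (simp add: frac_less2)
        then have "((\<lambda>t::real. \<bar>t\<bar> powr (1 / \<kappa> - 1 / k)) \<longlongrightarrow> 0) (at 0)"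
          by (intro tendsto_eq_intros) auto
        then have "((\<lambda>t. ereal (\<bar>t\<bar> powr (1 / \<kappa> - 1 / k))) \<longlongrightarrow> ereal 0) (at 0)" by simp
        then have "((\<lambda>t. ereal (sep dens_pos dens_neg x t / \<bar>t\<bar> powr (1 / k))) \<longlongrightarrow> ereal 0) (at 0)"
          by (subst tendsto_cong[OF ev])
        with lim have "L = ereal 0" by (intro tendsto_unique[of "at 0"]) auto
        then show False using L by simp
      qed
      then show "ennreal k \<le> ennreal \<kappa>" by (rule ennreal_leI)
    qed
  qed
qed

lemma perturbed_pair_in_class:
  assumes "f \<in> holder_ball \<beta> \<Lambda>"
  shows "perturbed_pair (profile \<kappa> \<Delta> f) \<in> pair_class \<beta> \<Lambda> \<kappa>"
proof -
  interpret cube: prob_space "cube_measure :: 'm point measure" by (rule prob_space_cube)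
  have m: "profile \<kappa> \<Delta> f \<in> borel_measurable cube_measure"
    by (intro measurable_cube_measureI profile_measurable)
  have int: "integrable cube_measure (profile \<kappa> \<Delta> f)"
    using m profile_abs_le by (intro cube.integrable_const_bound[where B = "1 / 2"]) auto
  have cube_prob: "measure cube_measure (unit_cube :: 'm point set) = 1" using cube.prob_space by simp
  have dens: "bounded_density dens_pos" "bounded_density dens_neg"
    unfolding bounded_density_def perturbed_pair_def using m
    by (auto simp: int profile_integral cube_prob intro!: exI[of _ 2] dest: profile_abs_le)
  have bayes: "bayes_region dens_pos dens_neg = fragment f"
    using profile_nonneg_iff by (auto simp: bayes_region_def fragment_def perturbed_pair_def)
  let ?x0 = "(0, f 0) :: 'm point"
  have x0: "?x0 \<in> boundary f" using frontier_bounds[of 0] by (auto simp: boundary_def unit_cube_def)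
  have inf: "(INF x \<in> boundary f. sep_exponent dens_pos dens_neg x) = ennreal \<kappa>"
  proof (rule antisym)
    show "(INF x \<in> boundary f. sep_exponent dens_pos dens_neg x) \<le> ennreal \<kappa>"
      using sep_exponent_zero_column[OF x0] by (intro INF_lower2[OF x0]) simp
    show "ennreal \<kappa> \<le> (INF x \<in> boundary f. sep_exponent dens_pos dens_neg x)"
    proof (rule INF_greatest)
      fix x assume "x \<in> boundary f"
      then show "ennreal \<kappa> \<le> sep_exponent dens_pos dens_neg x"
        using sep_exponent_zero_column[of x] sep_exponent_other_column[of x] by (cases "fst x = 0") auto
    qed
  qed
  have inv: "enn2real (1 / ennreal \<kappa>) = 1 / \<kappa>"
    using \<kappa> by (simp add: divide_ennreal flip: ennreal_1)
  have marg: "localized_margin dens_pos dens_neg f"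
    unfolding localized_margin_def
  \<comment> \<open>The constant is the reciprocal of the lower bound 2 \<Delta> \<open>lo\<close>
    off the column over \<open>0\<close>. It is at least 1, so it also serves as the upper
    bound.\<close>
  proof (rule exI[of _ 1], rule conjI[OF zero_less_one], rule exI[of _ "1 / (2 * \<Delta> * lo)"],
      intro conjI ballI allI impI)
    have "lo \<le> 1 / 2" using lo(2)[of 0] hi[of 0] by simp
    then have C: "2 * \<Delta> * lo \<le> 1 * 1" using \<Delta> lo(1) by (intro mult_mono) auto
    then have C': "1 \<le> 1 / (2 * \<Delta> * lo)" using \<Delta> lo(1) by (simp add: field_simps)
    show "0 < 1 / (2 * \<Delta> * lo)" using \<Delta> lo by simp
    fix x t assume x: "x \<in> boundary f" and "0 < \<bar>t\<bar> \<and> \<bar>t\<bar> < 1 \<and> shift_last x t \<in> unit_cube"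
    then have t: "t \<noteq> 0" by auto
    have "2 * \<Delta> * lo \<le> sep dens_pos dens_neg x t / \<bar>t\<bar> powr enn2real (1 / sep_exponent dens_pos dens_neg x) \<and>
      sep dens_pos dens_neg x t / \<bar>t\<bar> powr enn2real (1 / sep_exponent dens_pos dens_neg x) \<le> 1"
    proof (cases "fst x = 0")
      case True
      then show ?thesis
        using sep_zero_column[OF x True t] sep_exponent_zero_column[OF x True] t C by (simp add: inv)
    next
      \<comment> \<open>The exponent is \<infinity> here, so its reciprocal is 0 and the denominator
        is \<bar>t\<bar>^0 = 1 for t \<noteq> 0.\<close>
      case False
      then show ?thesis
        using sep_other_column[OF x False t] sep_exponent_other_column[OF x False] t
        by (simp add: ennreal_divide_top)
    qed
    then show "1 / (1 / (2 * \<Delta> * lo)) \<le> sep dens_pos dens_neg x t / \<bar>t\<bar> powr enn2real (1 / sep_exponent dens_pos dens_neg x)"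
      "sep dens_pos dens_neg x t / \<bar>t\<bar> powr enn2real (1 / sep_exponent dens_pos dens_neg x) \<le> 1 / (2 * \<Delta> * lo)"
      using C' by auto
  qed
  have "(dens_pos, dens_neg) \<in> pair_class \<beta> \<Lambda> \<kappa>"
    unfolding pair_class_def using dens assms bayes boundary_null inf marg by auto
  then show ?thesis by simp
qed

end

section \<open>Perturbed uniform laws\<close>

text \<open>The bound 1/2 keeps 1 + \<eta> and 1 - \<eta> at least 1/2, so likelihood ratios between
  two such laws are bounded.\<close>

definition centred_perturbation :: "('m::finite point \<Rightarrow> real) \<Rightarrow> bool" where
  "centred_perturbation \<eta> \<longleftrightarrow> \<eta> \<in> borel_measurable cube_measure \<and> (\<forall>x\<in>unit_cube. \<bar>\<eta> x\<bar> \<le> 1 / 2) \<and>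
     (\<integral>x. \<eta> x \<partial>cube_measure) = 0"

abbreviation label_measure :: "('m::finite point \<times> int) measure" where
  "label_measure \<equiv> cube_measure \<Otimes>\<^sub>M count_space {-1, 1}"

abbreviation perturbed_law :: "('m point \<Rightarrow> real) \<Rightarrow> ('m::finite point \<times> int) measure" where
  "perturbed_law \<eta> \<equiv> sample_law (fst (perturbed_pair \<eta>)) (snd (perturbed_pair \<eta>))"

abbreviation perturbed_data_law :: "('m point \<Rightarrow> real) \<Rightarrow> nat \<Rightarrow> 'm::finite dataset measure" where
  "perturbed_data_law \<eta> n \<equiv> data_law (fst (perturbed_pair \<eta>)) (snd (perturbed_pair \<eta>)) n"

section \<open>The law of one labelled observation and its risk\<close>

lemma sets_sample_law [measurable_cong]: "sets (sample_law p q) = sets label_measure"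
  by (simp add: sample_law_def)

lemma space_sample_law: "space (sample_law p q) = unit_cube \<times> {-1, 1}"
  by (simp add: sample_law_def space_pair_measure)

lemma measurable_label_measureI:
  assumes "\<And>y. y \<in> {-1, 1} \<Longrightarrow> (\<lambda>x. F (x, y)) \<in> measurable cube_measure N"
  shows "F \<in> measurable label_measure N"
proof -
  have "(\<lambda>z. F (snd z, fst z)) \<in> measurable (count_space {-1, 1} \<Otimes>\<^sub>M cube_measure) N"
    using assms by (intro measurable_pair_measure_countable1) auto
  from measurable_compose[OF measurable_pair_swap' this] show ?thesis by (simp add: case_prod_beta)
qed

lemma label_integral:
  fixes F :: "'m::finite point \<times> int \<Rightarrow> real"
  assumes F: "F \<in> borel_measurable label_measure"
    and B: "\<And>z. z \<in> unit_cube \<times> {-1, 1} \<Longrightarrow> \<bar>F z\<bar> \<le> B"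
  shows "integrable label_measure F"
    "(\<integral>z. F z \<partial>label_measure) = (\<integral>x. F (x, -1) + F (x, 1) \<partial>cube_measure)"
proof -
  interpret cube: prob_space "cube_measure :: 'm point measure" by (rule prob_space_cube)
  interpret lab: finite_measure "count_space {-1, 1 :: int}" by (rule finite_measure_count_space) simp
  interpret P: pair_sigma_finite "cube_measure :: 'm point measure" "count_space {-1, 1 :: int}" ..
  interpret fin: finite_measure "label_measure :: ('m point \<times> int) measure"
    by (rule finite_measure_pair_measure) unfold_locales
  show int: "integrable label_measure F"
    using F B by (intro fin.integrable_const_bound[where B = B]) (auto simp: space_pair_measure)
  show "(\<integral>z. F z \<partial>label_measure) = (\<integral>x. F (x, -1) + F (x, 1) \<partial>cube_measure)"
    by (subst P.integral_fst'[OF int, symmetric]) (simp add: lebesgue_integral_count_space_finite)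
qed

text \<open>The joint density with respect to the uniform law times counting measure. Summed over
  the two labels it gives 1, which is the uniformity of the points.\<close>

definition label_density :: "('m point \<Rightarrow> real) \<Rightarrow> 'm::finite point \<times> int \<Rightarrow> real" where
  "label_density \<eta> z = (1 + of_int (snd z) * \<eta> (fst z)) / 2"

text \<open>Half of |p - q| on the symmetric difference of the estimated and the Bayes
  region.\<close>

definition excess_integrand ::
    "('m point \<Rightarrow> real) \<Rightarrow> ('m::finite point \<Rightarrow> real) \<Rightarrow> 'm point \<Rightarrow> real" where
  "excess_integrand \<eta> f x = (if (0 \<le> f x) = (0 \<le> \<eta> x) then 0 else \<bar>\<eta> x\<bar>)"

context
  fixes \<eta> :: "'m::finite point \<Rightarrow> real"
  assumes cp: "centred_perturbation \<eta>"
begin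

lemma perturbation_measurable [measurable]: "\<eta> \<in> borel_measurable cube_measure"
  using cp by (simp add: centred_perturbation_def)

lemma perturbation_abs_le: "x \<in> unit_cube \<Longrightarrow> \<bar>\<eta> x\<bar> \<le> 1 / 2"
  using cp by (simp add: centred_perturbation_def)

lemma label_density_measurable [measurable]: "label_density \<eta> \<in> borel_measurable label_measure"
  unfolding label_density_def by (intro measurable_label_measureI) simp

lemma label_density_bounds:
  assumes "z \<in> unit_cube \<times> {-1, 1}"
  shows "1 / 4 \<le> label_density \<eta> z" "label_density \<eta> z \<le> 1"
  using assms perturbation_abs_le[of "fst z"] by (auto simp: label_density_def abs_le_iff)

lemma perturbed_law_eq: "perturbed_law \<eta> = density label_measure (\<lambda>z. ennreal (label_density \<eta> z))"
  unfolding sample_law_def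
proof (rule density_cong)
  show "(\<lambda>(x, y). ennreal (1 / 2 * (if y = 1 then fst (perturbed_pair \<eta>) x else snd (perturbed_pair \<eta>) x)))
      \<in> borel_measurable label_measure"
    by (intro measurable_label_measureI) (auto simp: perturbed_pair_def)
  show "AE z in label_measure.
      (case z of (x, y) \<Rightarrow> ennreal (1 / 2 * (if y = 1 then fst (perturbed_pair \<eta>) x else snd (perturbed_pair \<eta>) x)))
      = ennreal (label_density \<eta> z)"
    by (rule AE_I2) (auto simp: perturbed_pair_def space_pair_measure label_density_def)
qed simp

lemma perturbed_law_integral:
  fixes F :: "'m point \<times> int \<Rightarrow> real"
  assumes F [measurable]: "F \<in> borel_measurable label_measure"
    and B: "\<And>z. z \<in> unit_cube \<times> {-1, 1} \<Longrightarrow> \<bar>F z\<bar> \<le> B"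
  shows "integrable (perturbed_law \<eta>) F"
    "(\<integral>z. F z \<partial>perturbed_law \<eta>) = (\<integral>x. (1 - \<eta> x) / 2 * F (x, -1) + (1 + \<eta> x) / 2 * F (x, 1) \<partial>cube_measure)"
proof -
  have ae: "AE z in label_measure. 0 \<le> label_density \<eta> z"
  proof (rule AE_I2)
    fix z assume "z \<in> space (label_measure :: ('m point \<times> int) measure)"
    then have "z \<in> unit_cube \<times> {-1, 1}" by (simp add: space_pair_measure)
    from label_density_bounds(1)[OF this] show "0 \<le> label_density \<eta> z" by linarith
  qed
  have m: "(\<lambda>z. label_density \<eta> z * F z) \<in> borel_measurable label_measure" by measurable
  have b: "\<bar>label_density \<eta> z * F z\<bar> \<le> 1 * B" if "z \<in> unit_cube \<times> {-1, 1}" for z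
    unfolding abs_mult using label_density_bounds[OF that] B[OF that] by (intro mult_mono) auto
  show "integrable (perturbed_law \<eta>) F"
    unfolding perturbed_law_eq using label_integral(1)[OF m b] ae
    by (subst integrable_density) auto
  show "(\<integral>z. F z \<partial>perturbed_law \<eta>) = (\<integral>x. (1 - \<eta> x) / 2 * F (x, -1) + (1 + \<eta> x) / 2 * F (x, 1) \<partial>cube_measure)"
    unfolding perturbed_law_eq using label_integral(2)[OF m b] ae
    by (subst integral_density) (auto simp: label_density_def)
qed

lemma prob_space_perturbed_law: "prob_space (perturbed_law \<eta>)"
proof -
  interpret cube: prob_space "cube_measure :: 'm point measure" by (rule prob_space_cube)
  have "(\<integral>z. (1 :: real) \<partial>perturbed_law \<eta>) = (\<integral>x. (1 - \<eta> x) / 2 * 1 + (1 + \<eta> x) / 2 * 1 \<partial>cube_measure)"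
    by (rule perturbed_law_integral(2)[of "\<lambda>_. 1" 1]) simp_all
  moreover have "(\<lambda>x. (1 - \<eta> x) / 2 * 1 + (1 + \<eta> x) / 2 * 1) = (\<lambda>x. 1)"
    by (auto simp: fun_eq_iff add_divide_distrib diff_divide_distrib)
  ultimately have "measure (perturbed_law \<eta>) (space (perturbed_law \<eta>)) = 1"
    using cube.prob_space by simp
  moreover from this have "emeasure (perturbed_law \<eta>) (space (perturbed_law \<eta>)) \<noteq> \<top>"
    by (auto simp: measure_def)
  ultimately show ?thesis
    by (intro prob_spaceI) (simp add: emeasure_eq_ennreal_measure)
qed

lemma risk_eq:
  fixes c :: "'m point \<Rightarrow> int"
  assumes c [measurable]: "c \<in> measurable cube_measure (count_space UNIV)" and c1: "\<And>x. c x \<in> {-1, 1}"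
  shows "risk (fst (perturbed_pair \<eta>)) (snd (perturbed_pair \<eta>)) c =
    (\<integral>x. (if c x = 1 then 1 - \<eta> x else 1 + \<eta> x) / 2 \<partial>cube_measure)"
proof -
  let ?A = "{(x, y) \<in> space (perturbed_law \<eta>). c x \<noteq> y}"
  have ind: "indicat_real ?A (x, y) = (if c x \<noteq> y then 1 else 0)" if "x \<in> unit_cube" "y \<in> {-1, 1}" for x y
    using that by (auto simp: space_sample_law)
  have m: "(\<lambda>z. indicat_real ?A z) \<in> borel_measurable label_measure"
  proof (rule measurable_label_measureI)
    fix y :: int assume "y \<in> {-1, 1}"
    then have "(\<lambda>x. indicat_real ?A (x, y)) \<in> borel_measurable cube_measure \<longleftrightarrow>
        (\<lambda>x. if c x \<noteq> y then 1 else 0 :: real) \<in> borel_measurable cube_measure"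
      by (intro measurable_cong) (simp add: ind)
    then show "(\<lambda>x. indicat_real ?A (x, y)) \<in> borel_measurable cube_measure" by simp
  qed
  have "risk (fst (perturbed_pair \<eta>)) (snd (perturbed_pair \<eta>)) c = (\<integral>z. indicat_real ?A z \<partial>perturbed_law \<eta>)"
    unfolding risk_def by (simp add: Int_absorb2 subset_eq)
  also have "\<dots> = (\<integral>x. (1 - \<eta> x) / 2 * indicat_real ?A (x, -1) + (1 + \<eta> x) / 2 * indicat_real ?A (x, 1) \<partial>cube_measure)"
    by (rule perturbed_law_integral(2)[OF m, of 1]) (auto simp: indicator_def)
  also have "\<dots> = (\<integral>x. (if c x = 1 then 1 - \<eta> x else 1 + \<eta> x) / 2 \<partial>cube_measure)"
  proof (rule Bochner_Integration.integral_cong)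
    fix x :: "'m point" assume "x \<in> space cube_measure"
    then show "(1 - \<eta> x) / 2 * indicat_real ?A (x, -1) + (1 + \<eta> x) / 2 * indicat_real ?A (x, 1) =
        (if c x = 1 then 1 - \<eta> x else 1 + \<eta> x) / 2"
      using c1[of x] by (subst (1 2) ind) auto
  qed simp
  finally show ?thesis .
qed

lemma excess_integrand_integrable:
  assumes [measurable]: "f \<in> borel_measurable cube_measure"
  shows "integrable cube_measure (excess_integrand \<eta> f)"
proof -
  interpret cube: prob_space "cube_measure :: 'm point measure" by (rule prob_space_cube)
  show ?thesis unfolding excess_integrand_def
    by (intro cube.integrable_const_bound[where B = "1 / 2"] AE_I2) (auto dest: perturbation_abs_le)
qed

text \<open>Label 1 at x errs with probability (1 - \<eta>) / 2 and label -1 with (1 + \<eta>) / 2,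
  so the wrong one of the two costs |\<eta>| more than the Bayes choice.\<close>

lemma excess_risk_eq:
  assumes [measurable]: "f \<in> borel_measurable cube_measure"
  shows "excess_risk (fst (perturbed_pair \<eta>)) (snd (perturbed_pair \<eta>)) f =
    (\<integral>x. excess_integrand \<eta> f x \<partial>cube_measure)"
proof -
  interpret cube: prob_space "cube_measure :: 'm point measure" by (rule prob_space_cube)
  have int: "integrable cube_measure (\<lambda>x. (if c x = 1 then 1 - \<eta> x else 1 + \<eta> x) / 2)"
    if [measurable]: "c \<in> measurable cube_measure (count_space UNIV)" for c :: "'m point \<Rightarrow> int"
  proof (rule cube.integrable_const_bound[where B = 1])
    show "AE x in cube_measure. norm ((if c x = 1 then 1 - \<eta> x else 1 + \<eta> x) / 2) \<le> 1"
      using perturbation_abs_le by (intro AE_I2) (fastforce simp: abs_le_iff)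
  qed measurable
  let ?b = "set_classifier (bayes_region (fst (perturbed_pair \<eta>)) (snd (perturbed_pair \<eta>)))"
  have b: "?b x = (if 0 \<le> \<eta> x then 1 else -1)" if "x \<in> unit_cube" for x
    using that by (simp add: set_classifier_def bayes_region_def perturbed_pair_def)
  have "?b \<in> measurable cube_measure (count_space UNIV) \<longleftrightarrow>
      (\<lambda>x. if 0 \<le> \<eta> x then 1 else -1 :: int) \<in> measurable cube_measure (count_space UNIV)"
    by (intro measurable_cong) (simp add: b)
  then have [measurable]: "?b \<in> measurable cube_measure (count_space UNIV)" by simp
  have [measurable]: "sign_classifier f \<in> measurable cube_measure (count_space UNIV)"
    unfolding sign_classifier_def by measurable
  have "excess_risk (fst (perturbed_pair \<eta>)) (snd (perturbed_pair \<eta>)) f =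
    (\<integral>x. (if sign_classifier f x = 1 then 1 - \<eta> x else 1 + \<eta> x) / 2 \<partial>cube_measure) -
    (\<integral>x. (if ?b x = 1 then 1 - \<eta> x else 1 + \<eta> x) / 2 \<partial>cube_measure)"
    unfolding excess_risk_def by (subst (1 2) risk_eq) (auto simp: sign_classifier_def set_classifier_def)
  also have "\<dots> = (\<integral>x. (if sign_classifier f x = 1 then 1 - \<eta> x else 1 + \<eta> x) / 2 -
      (if ?b x = 1 then 1 - \<eta> x else 1 + \<eta> x) / 2 \<partial>cube_measure)"
    by (rule Bochner_Integration.integral_diff[symmetric]; rule int) measurable
  also have "\<dots> = (\<integral>x. excess_integrand \<eta> f x \<partial>cube_measure)"
    by (rule Bochner_Integration.integral_cong)
      (auto simp: b excess_integrand_def sign_classifier_def field_simps)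
  finally show ?thesis .
qed

lemma prob_space_perturbed_data_law: "prob_space (perturbed_data_law \<eta> n)"
  unfolding data_law_def by (intro prob_space_PiM prob_space_perturbed_law)

end

declare perturbation_measurable [measurable del] label_density_measurable [measurable del]

section \<open>Likelihood ratios and tests for product laws\<close>

lemma sets_data_law: "sets (data_law p q n) = sets (\<Pi>\<^sub>M i \<in> {..<n}. label_measure)"
  unfolding data_law_def by (intro sets_PiM_cong) (auto simp: sets_sample_law)

lemma space_data_law: "space (data_law p q n) = space (\<Pi>\<^sub>M i \<in> {..<n}. label_measure)"
  by (rule sets_eq_imp_space_eq[OF sets_data_law])

lemma PiM_density:
  fixes M :: "'a measure" and l :: "'a \<Rightarrow> real"
  assumes "finite I" "prob_space M" "prob_space (density M (\<lambda>x. ennreal (l x)))"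
    and l [measurable]: "l \<in> borel_measurable M" and l0: "\<And>x. x \<in> space M \<Longrightarrow> 0 \<le> l x"
  shows "(\<Pi>\<^sub>M i \<in> I. density M (\<lambda>x. ennreal (l x))) =
    density (\<Pi>\<^sub>M i \<in> I. M) (\<lambda>z. ennreal (\<Prod>i\<in>I. l (z i)))"
proof -
  interpret M: prob_space M by fact
  interpret N: prob_space "density M (\<lambda>x. ennreal (l x))" by fact
  interpret PM: product_sigma_finite "\<lambda>i. M" by standard
  interpret PN: product_sigma_finite "\<lambda>i. density M (\<lambda>x. ennreal (l x))" by standard
  have [measurable]: "(\<lambda>z. \<Prod>i\<in>I. l (z i)) \<in> borel_measurable (\<Pi>\<^sub>M i \<in> I. M)" by measurable
  show ?thesis
  proof (rule PN.PiM_eqI[symmetric])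
    show "sets (density (\<Pi>\<^sub>M i \<in> I. M) (\<lambda>z. ennreal (\<Prod>i\<in>I. l (z i)))) =
        sets (\<Pi>\<^sub>M i \<in> I. density M (\<lambda>x. ennreal (l x)))"
      by (simp, intro sets_PiM_cong) auto
    fix A assume A: "\<And>i. i \<in> I \<Longrightarrow> A i \<in> sets (density M (\<lambda>x. ennreal (l x)))"
    then have A' [measurable]: "\<And>i. i \<in> I \<Longrightarrow> A i \<in> sets M" by simp
    have "Pi\<^sub>E I A \<in> sets (\<Pi>\<^sub>M i \<in> I. M)" using assms(1) A' by (intro sets_PiM_I_finite) auto
    then have "emeasure (density (\<Pi>\<^sub>M i \<in> I. M) (\<lambda>z. ennreal (\<Prod>i\<in>I. l (z i)))) (Pi\<^sub>E I A) =
        (\<integral>\<^sup>+ z. ennreal (\<Prod>i\<in>I. l (z i)) * indicator (Pi\<^sub>E I A) z \<partial>(\<Pi>\<^sub>M i \<in> I. M))"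
      by (subst emeasure_density) auto
    also have "\<dots> = (\<integral>\<^sup>+ z. (\<Prod>i\<in>I. ennreal (l (z i)) * indicator (A i) (z i)) \<partial>(\<Pi>\<^sub>M i \<in> I. M))"
    proof (rule nn_integral_cong)
      fix z assume z: "z \<in> space (\<Pi>\<^sub>M i \<in> I. M)"
      have "ennreal (\<Prod>i\<in>I. l (z i)) = (\<Prod>i\<in>I. ennreal (l (z i)))"
        using z l0 by (intro prod_ennreal[symmetric]) (auto simp: space_PiM PiE_iff)
      moreover have "indicator (Pi\<^sub>E I A) z = (\<Prod>i\<in>I. indicator (A i) (z i) :: ennreal)"
        using z assms(1) by (auto simp: indicator_def space_PiM PiE_iff prod_eq_1_iff intro!: prod_zero[symmetric])
      ultimately show "ennreal (\<Prod>i\<in>I. l (z i)) * indicator (Pi\<^sub>E I A) z =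
          (\<Prod>i\<in>I. ennreal (l (z i)) * indicator (A i) (z i))"
        by (simp add: prod.distrib)
    qed
    also have "\<dots> = (\<Prod>i\<in>I. \<integral>\<^sup>+ x. ennreal (l x) * indicator (A i) x \<partial>M)"
      using assms(1) by (intro PM.product_nn_integral_prod) auto
    also have "\<dots> = (\<Prod>i\<in>I. emeasure (density M (\<lambda>x. ennreal (l x))) (A i))"
      by (intro prod.cong refl) (simp add: emeasure_density)
    finally show "emeasure (density (\<Pi>\<^sub>M i \<in> I. M) (\<lambda>z. ennreal (\<Prod>i\<in>I. l (z i)))) (Pi\<^sub>E I A) =
        (\<Prod>i\<in>I. emeasure (density M (\<lambda>x. ennreal (l x))) (A i))" .
  qed fact
qed

text \<open>For the likelihood ratio L of the product laws, E L = 1, and E L^2 is the power of the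
  one-observation moment. So E (L - 1)^2 \<le> 1/4, and the two laws differ on A by E ((L - 1) 1_A)
  \<le> 1/4 + 1/4.\<close>

lemma testing_error_product:
  fixes M :: "'a measure" and l :: "'a \<Rightarrow> real"
  assumes "finite I" "prob_space M" "prob_space (density M (\<lambda>x. ennreal (l x)))"
    and l [measurable]: "l \<in> borel_measurable M"
    and lB: "\<And>x. x \<in> space M \<Longrightarrow> 0 \<le> l x \<and> l x \<le> B"
    and sq: "(\<integral>x. (l x)\<^sup>2 \<partial>M) ^ card I \<le> 5 / 4"
    and A: "A \<in> sets (\<Pi>\<^sub>M i \<in> I. M)"
  shows "1 / 2 \<le> measure (\<Pi>\<^sub>M i \<in> I. M) A +
    measure (\<Pi>\<^sub>M i \<in> I. density M (\<lambda>x. ennreal (l x))) (space (\<Pi>\<^sub>M i \<in> I. M) - A)"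
proof -
  interpret M: prob_space M by fact
  interpret N: prob_space "density M (\<lambda>x. ennreal (l x))" by fact
  interpret PM: product_sigma_finite "\<lambda>i. M" by standard
  interpret P: prob_space "\<Pi>\<^sub>M i \<in> I. M" by (intro prob_space_PiM assms)
  interpret Q: prob_space "\<Pi>\<^sub>M i \<in> I. density M (\<lambda>x. ennreal (l x))" by (intro prob_space_PiM assms)
  let ?P = "\<Pi>\<^sub>M i \<in> I. M" and ?Q = "\<Pi>\<^sub>M i \<in> I. density M (\<lambda>x. ennreal (l x))"
  define L where "L z = (\<Prod>i\<in>I. l (z i))" for z
  have Lm [measurable]: "L \<in> borel_measurable ?P" unfolding L_def by measurable
  have Q: "?Q = density ?P (\<lambda>z. ennreal (L z))"
    unfolding L_def using lB by (intro PiM_density assms) auto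
  have intl: "integrable M l" "integrable M (\<lambda>x. (l x)\<^sup>2)"
    using lB by (intro M.integrable_const_bound[where B = B] M.integrable_const_bound[where B = "B\<^sup>2"] AE_I2;
        simp add: power_mono)+
  have z0: "z i \<in> space M" if "z \<in> space ?P" "i \<in> I" for z i using that by (auto simp: space_PiM)
  have L0: "0 \<le> L z" if "z \<in> space ?P" for z
    unfolding L_def using that lB z0 by (intro prod_nonneg) auto
  have "(\<integral>x. l x \<partial>M) = 1"
  proof -
    have "emeasure (density M (\<lambda>x. ennreal (l x))) (space M) = 1" using N.emeasure_space_1 by simp
    then have "(\<integral>\<^sup>+ x. ennreal (l x) \<partial>M) = 1"
      by (subst (asm) emeasure_density) (auto cong: nn_integral_cong)
    then show ?thesis using lB by (subst integral_eq_nn_integral) auto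
  qed
  then have EL: "(\<integral>z. L z \<partial>?P) = 1"
    unfolding L_def using assms(1) intl by (subst PM.product_integral_prod) auto
  have "(\<integral>z. (L z)\<^sup>2 \<partial>?P) = (\<integral>z. (\<Prod>i\<in>I. (l (z i))\<^sup>2) \<partial>?P)"
    by (simp add: L_def prod_power_distrib)
  also have "\<dots> = (\<Prod>i\<in>I. \<integral>x. (l x)\<^sup>2 \<partial>M)"
    using assms(1) intl by (intro PM.product_integral_prod) auto
  finally have EL2: "(\<integral>z. (L z)\<^sup>2 \<partial>?P) \<le> 5 / 4" using sq by simp
  have int1: "integrable ?P L"
    unfolding L_def using assms(1) intl by (intro PM.product_integrable_prod) auto
  have int2: "integrable ?P (\<lambda>z. (L z)\<^sup>2)"
    unfolding L_def prod_power_distrib using assms(1) intl by (intro PM.product_integrable_prod) auto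
  have intd: "integrable ?P (\<lambda>z. (L z - 1) * indicat_real A z)"
    using int1 A by (intro integrable_real_mult_indicator) auto
  have "(\<integral>z. (L z - 1) * indicat_real A z \<partial>?P) \<le> (\<integral>z. (L z)\<^sup>2 - 2 * L z + (5 / 4) \<partial>?P)"
  proof (rule integral_mono[OF intd])
    show "integrable ?P (\<lambda>z. (L z)\<^sup>2 - 2 * L z + 5 / 4)" using int1 int2 by auto
    fix z
    \<comment> \<open>\<open>L - 1 \<le> (L - 1)\<^sup>2 + 1/4\<close> replaces the Cauchy-Schwarz inequality\<close>
    have "0 \<le> (L z - 1)\<^sup>2" "0 \<le> (L z - 3 / 2)\<^sup>2" by auto
    then show "(L z - 1) * indicat_real A z \<le> (L z)\<^sup>2 - 2 * L z + 5 / 4"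
      by (auto simp: indicator_def power2_eq_square algebra_simps)
  qed
  also have "\<dots> = (\<integral>z. (L z)\<^sup>2 \<partial>?P) - 2 * (\<integral>z. L z \<partial>?P) + 5 / 4"
    using int1 int2 by (simp add: P.prob_space)
  also have "\<dots> \<le> 1 / 2" using EL EL2 by simp
  finally have D: "(\<integral>z. (L z - 1) * indicat_real A z \<partial>?P) \<le> 1 / 2" .
  have QA: "measure ?Q A = (\<integral>z. L z * indicat_real A z \<partial>?P)"
  proof -
    have "emeasure ?Q A = (\<integral>\<^sup>+ z. ennreal (L z * indicat_real A z) \<partial>?P)"
      unfolding Q using A by (subst emeasure_density) (auto intro!: nn_integral_cong simp: indicator_def)
    then show ?thesis
      unfolding measure_def using A L0 by (subst integral_eq_nn_integral) auto
  qed
  have "(\<integral>z. (L z - 1) * indicat_real A z \<partial>?P) = measure ?Q A - measure ?P A"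
  proof -
    have "(\<integral>z. (L z - 1) * indicat_real A z \<partial>?P) =
        (\<integral>z. L z * indicat_real A z - indicat_real A z \<partial>?P)" by (simp add: algebra_simps)
    also have "\<dots> = (\<integral>z. L z * indicat_real A z \<partial>?P) - (\<integral>z. indicat_real A z \<partial>?P)"
      using A int1 P.emeasure_finite[of A]
      by (intro Bochner_Integration.integral_diff integrable_real_mult_indicator integrable_real_indicator)
        (auto simp: less_top[symmetric])
    also have "(\<integral>z. indicat_real A z \<partial>?P) = measure ?P A"
      using sets.sets_into_space[OF A] by (simp add: Int_absorb2)
    finally show ?thesis unfolding QA .
  qed
  moreover have "measure ?Q (space ?P - A) = 1 - measure ?Q A"
  proof -
    have "space ?P = space ?Q" "A \<in> sets ?Q" using A by (simp_all add: Q)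
    then show ?thesis using Q.prob_compl by simp
  qed
  ultimately show ?thesis using D by simp
qed

text \<open>The left side is the second moment of the likelihood ratio of the label at a fixed
  point. It equals 1 + (e' - e)^2 / (1 - e^2), and |e| \<le> 1/2 keeps the denominator above
  1/2.\<close>

lemma chi_square_pointwise:
  fixes e e' :: real
  assumes "\<bar>e\<bar> \<le> 1 / 2"
  shows "(1 - e) / 2 * ((1 - e') / 2 / ((1 - e) / 2))\<^sup>2 + (1 + e) / 2 * ((1 + e') / 2 / ((1 + e) / 2))\<^sup>2
    \<le> 1 + 2 * (e' - e)\<^sup>2"
proof -
  have e: "0 < 1 - e" "0 < 1 + e" using assms by auto
  have "e\<^sup>2 \<le> (1 / 2)\<^sup>2" using assms by (intro power2_le_iff_abs_le[THEN iffD2]) auto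
  then have sq: "1 / 2 \<le> 1 - e\<^sup>2" by (simp add: power2_eq_square)
  have "(1 - e) / 2 * ((1 - e') / 2 / ((1 - e) / 2))\<^sup>2 + (1 + e) / 2 * ((1 + e') / 2 / ((1 + e) / 2))\<^sup>2 =
      ((1 - e')\<^sup>2 / (1 - e) + (1 + e')\<^sup>2 / (1 + e)) / 2"
  proof -
    have *: "u / 2 * (w / 2 / (u / 2))\<^sup>2 = w\<^sup>2 / u / 2" if "0 < u" for u w :: real
      using that by (simp add: power2_eq_square)
    show ?thesis unfolding *[OF e(1)] *[OF e(2)] by (rule add_divide_distrib[symmetric])
  qed
  also have "\<dots> = 1 + (e' - e)\<^sup>2 / (1 - e\<^sup>2)"
  proof -
    have "(1 - e')\<^sup>2 / (1 - e) + (1 + e')\<^sup>2 / (1 + e) = ((1 - e')\<^sup>2 * (1 + e) + (1 + e')\<^sup>2 * (1 - e)) / (1 - e\<^sup>2)"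
      using e sq by (simp add: add_frac_eq power2_eq_square algebra_simps)
    also have "\<dots> = (2 * (1 - e\<^sup>2) + 2 * (e' - e)\<^sup>2) / (1 - e\<^sup>2)"
      by (simp add: power2_eq_square algebra_simps)
    also have "\<dots> = 2 + 2 * (e' - e)\<^sup>2 / (1 - e\<^sup>2)"
      using sq by (subst add_divide_distrib, subst nonzero_mult_div_cancel_right) auto
    also have "\<dots> = 2 * (1 + (e' - e)\<^sup>2 / (1 - e\<^sup>2))"
      by (simp only: distrib_left times_divide_eq_right mult_1_right)
    finally show ?thesis by (simp only:) simp
  qed
  also have "(e' - e)\<^sup>2 / (1 - e\<^sup>2) \<le> (e' - e)\<^sup>2 / (1 / 2)"
    using sq by (intro divide_left_mono) auto
  finally show ?thesis by simp
qed

lemma perturbed_testing_error: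
  fixes \<eta> \<eta>' :: "'m::finite point \<Rightarrow> real"
  assumes cp: "centred_perturbation \<eta>" "centred_perturbation \<eta>'"
    and close: "real n * (\<integral>x. (\<eta>' x - \<eta> x)\<^sup>2 \<partial>cube_measure) \<le> 1 / 16"
    and A: "A \<in> sets (perturbed_data_law \<eta> n)"
  shows "1 / 2 \<le> measure (perturbed_data_law \<eta> n) A +
    measure (perturbed_data_law \<eta>' n) (space (perturbed_data_law \<eta> n) - A)"
proof -
  interpret cube: prob_space "cube_measure :: 'm point measure" by (rule prob_space_cube)
  note [measurable] = perturbation_measurable[OF cp(1)] perturbation_measurable[OF cp(2)]
    label_density_measurable[OF cp(1)] label_density_measurable[OF cp(2)]
  define l where "l z = label_density \<eta>' z / label_density \<eta> z" for z
  define \<tau> where "\<tau> = (\<integral>x. (\<eta>' x - \<eta> x)\<^sup>2 \<partial>cube_measure)"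
  have ld: "1 / 4 \<le> label_density \<eta> z" "0 \<le> label_density \<eta>' z" "label_density \<eta>' z \<le> 1"
    if "z \<in> unit_cube \<times> {-1, 1}" for z
    using label_density_bounds[OF cp(1) that] label_density_bounds[OF cp(2) that] by auto
  have lm: "l \<in> borel_measurable label_measure" unfolding l_def by measurable
  then have lm': "l \<in> borel_measurable (perturbed_law \<eta>)"
    by (simp cong: measurable_cong_sets add: sets_sample_law)
  have lB: "0 \<le> l z \<and> l z \<le> 4" if "z \<in> unit_cube \<times> {-1, 1}" for z
    using ld[OF that] by (auto simp: l_def divide_le_eq)
  have dens: "perturbed_law \<eta>' = density (perturbed_law \<eta>) (\<lambda>z. ennreal (l z))"
    unfolding perturbed_law_eq[OF cp(1)] perturbed_law_eq[OF cp(2)]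
  proof (subst density_density_eq)
    show "density label_measure (\<lambda>z. ennreal (label_density \<eta>' z)) =
        density label_measure (\<lambda>z. ennreal (label_density \<eta> z) * ennreal (l z))"
    proof (rule density_cong)
      show "AE z in label_measure. ennreal (label_density \<eta>' z) = ennreal (label_density \<eta> z) * ennreal (l z)"
      proof (rule AE_I2)
        fix z assume "z \<in> space (label_measure :: ('m point \<times> int) measure)"
        then have z: "z \<in> unit_cube \<times> {-1, 1}" by (simp add: space_pair_measure)
        then have "label_density \<eta>' z = label_density \<eta> z * l z" using ld[OF z] by (simp add: l_def)
        then show "ennreal (label_density \<eta>' z) = ennreal (label_density \<eta> z) * ennreal (l z)"
          using ld(1)[OF z] lB[OF z] by (simp add: ennreal_mult)
      qed
    qed (use lm in measurable)
  qed (use lm in measurable)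
  have b2: "(\<eta>' x - \<eta> x)\<^sup>2 \<le> 1" if "x \<in> unit_cube" for x
    using perturbation_abs_le[OF cp(1) that] perturbation_abs_le[OF cp(2) that]
    by (intro abs_square_le_1[THEN iffD2]) (auto simp: abs_le_iff)
  have intsq: "integrable cube_measure (\<lambda>x. (\<eta>' x - \<eta> x)\<^sup>2)"
    using b2 by (intro cube.integrable_const_bound[where B = 1] AE_I2) auto
  have "(\<integral>z. (l z)\<^sup>2 \<partial>perturbed_law \<eta>) =
      (\<integral>x. (1 - \<eta> x) / 2 * (l (x, -1))\<^sup>2 + (1 + \<eta> x) / 2 * (l (x, 1))\<^sup>2 \<partial>cube_measure)"
  proof (rule perturbed_law_integral(2)[OF cp(1)])
    show "(\<lambda>z. (l z)\<^sup>2) \<in> borel_measurable label_measure" using lm by measurable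
    show "\<bar>(l z)\<^sup>2\<bar> \<le> 4\<^sup>2" if "z \<in> unit_cube \<times> {-1, 1}" for z
      using lB[OF that] power_mono[of "l z" 4 2] by simp
  qed
  also have "\<dots> \<le> (\<integral>x. 1 + 2 * (\<eta>' x - \<eta> x)\<^sup>2 \<partial>cube_measure)"
  proof (rule integral_mono')
    show "integrable cube_measure (\<lambda>x. 1 + 2 * (\<eta>' x - \<eta> x)\<^sup>2)" using intsq by auto
    fix x :: "'m point" assume "x \<in> space cube_measure"
    then have "\<bar>\<eta> x\<bar> \<le> 1 / 2" using perturbation_abs_le[OF cp(1)] by simp
    then show "(1 - \<eta> x) / 2 * (l (x, -1))\<^sup>2 + (1 + \<eta> x) / 2 * (l (x, 1))\<^sup>2 \<le> 1 + 2 * (\<eta>' x - \<eta> x)\<^sup>2"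
      using chi_square_pointwise[of "\<eta> x" "\<eta>' x"] by (simp add: l_def label_density_def)
  qed auto
  also have "\<dots> = 1 + 2 * \<tau>" using intsq by (simp add: \<tau>_def cube.prob_space[simplified])
  finally have l2: "(\<integral>z. (l z)\<^sup>2 \<partial>perturbed_law \<eta>) \<le> 1 + 2 * \<tau>" .
  have \<tau>0: "0 \<le> \<tau>" by (simp add: \<tau>_def)
  \<comment> \<open>Origin of the 1/16: it bounds the n-th power by exp (1/8), which stays below the
    5/4 that \<open>testing_error_product\<close> tolerates.\<close>
  have "(\<integral>z. (l z)\<^sup>2 \<partial>perturbed_law \<eta>) ^ n \<le> (1 + 2 * \<tau>) ^ n"
    by (intro power_mono l2) simp
  also have "\<dots> \<le> exp (2 * \<tau>) ^ n"
    using \<tau>0 exp_ge_add_one_self[of "2 * \<tau>"] by (intro power_mono) auto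
  also have "\<dots> = exp (2 * (real n * \<tau>))" by (simp flip: exp_of_nat_mult add: mult_ac)
  also have "\<dots> \<le> exp (1 / 8)" using close by (simp add: \<tau>_def)
  also have "\<dots> \<le> 1 + 1 / 8 + (1 / 8)\<^sup>2" by (rule exp_bound) auto
  also have "\<dots> \<le> 5 / 4" by (simp add: power2_eq_square)
  finally have sq: "(\<integral>z. (l z)\<^sup>2 \<partial>perturbed_law \<eta>) ^ card {..<n} \<le> 5 / 4" by simp
  have "1 / 2 \<le> measure (\<Pi>\<^sub>M i \<in> {..<n}. perturbed_law \<eta>) A +
    measure (\<Pi>\<^sub>M i \<in> {..<n}. density (perturbed_law \<eta>) (\<lambda>x. ennreal (l x)))
      (space (\<Pi>\<^sub>M i \<in> {..<n}. perturbed_law \<eta>) - A)"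
  proof (rule testing_error_product[where B = 4])
    show "prob_space (perturbed_law \<eta>)" by (rule prob_space_perturbed_law[OF cp(1)])
    show "prob_space (density (perturbed_law \<eta>) (\<lambda>x. ennreal (l x)))"
      unfolding dens[symmetric] by (rule prob_space_perturbed_law[OF cp(2)])
    show "\<And>z. z \<in> space (perturbed_law \<eta>) \<Longrightarrow> 0 \<le> l z \<and> l z \<le> 4"
      using lB by (simp add: space_sample_law)
  qed (use sq lm' A in \<open>auto simp: data_law_def\<close>)
  then show ?thesis by (simp add: data_law_def dens)
qed

text \<open>\<open>T j\<close> is the event of guessing that j belongs to W. Flipping j is an
  involution on the subsets of J; each W together with its neighbour has error at least 1/2 at j, so
  the error at j averages at least 1/4 over all W. Summing over j, some W is at least as bad as the
  average.\<close>

lemma assouad: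
  fixes P :: "'j set \<Rightarrow> 'a measure" and T :: "'j \<Rightarrow> 'a set"
  assumes J: "finite J"
    and test: "\<And>W j. W \<subseteq> J \<Longrightarrow> j \<in> J \<Longrightarrow> j \<notin> W \<Longrightarrow>
      1 / 2 \<le> measure (P W) (T j) + measure (P (insert j W)) (S - T j)"
  shows "\<exists>W\<subseteq>J. real (card J) / 4 \<le> (\<Sum>j\<in>J. measure (P W) (if j \<in> W then S - T j else T j))"
proof (rule ccontr)
  assume neg: "\<not> ?thesis"
  define err where "err W j = measure (P W) (if j \<in> W then S - T j else T j)" for W j
  have half: "2 ^ card J / 4 \<le> (\<Sum>W\<in>Pow J. err W j)" if j: "j \<in> J" for j
  proof -
    define flip where "flip W = (if j \<in> W then W - {j} else insert j W)" for W
    have "(\<Sum>W\<in>Pow J. err (flip W) j) = (\<Sum>W\<in>Pow J. err W j)"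
      using j by (intro sum.reindex_bij_witness[of _ flip flip]) (auto simp: flip_def)
    then have "2 * (\<Sum>W\<in>Pow J. err W j) = (\<Sum>W\<in>Pow J. err W j + err (flip W) j)"
      by (simp add: sum.distrib)
    also have "\<dots> \<ge> (\<Sum>W\<in>Pow J. 1 / 2)"
    proof (rule sum_mono)
      fix W assume W: "W \<in> Pow J"
      show "1 / 2 \<le> err W j + err (flip W) j"
      proof (cases "j \<in> W")
        case True
        then have "1 / 2 \<le> measure (P (W - {j})) (T j) + measure (P (insert j (W - {j}))) (S - T j)"
          using W j by (intro test) auto
        then show ?thesis using True by (simp add: err_def flip_def insert_absorb)
      next
        case False
        then show ?thesis using test[of W j] W j by (simp add: err_def flip_def)
      qed
    qed
    finally show ?thesis using J by (simp add: card_Pow)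
  qed
  have "real (card J) * (2 ^ card J / 4) \<le> (\<Sum>j\<in>J. \<Sum>W\<in>Pow J. err W j)"
    using half by (intro sum_bounded_below)
  also have "\<dots> = (\<Sum>W\<in>Pow J. \<Sum>j\<in>J. err W j)" by (rule sum.swap)
  also have "\<dots> < (\<Sum>W\<in>Pow J. real (card J) / 4)"
    using neg J by (intro sum_strict_mono) (auto simp: err_def not_le)
  finally show False using J by (simp add: card_Pow)
qed

section \<open>The hypercube of perturbations\<close>

lemma emeasure_lborel_box:
  fixes j :: "'m::finite \<Rightarrow> int"
  assumes "1 \<le> M" "r \<le> s"
  shows "emeasure lborel (cbox (\<chi> i. (of_int (j i) + r) / real M) (\<chi> i. (of_int (j i) + s) / real M)) =
    ennreal (((s - r) / real M) ^ CARD('m))"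
proof -
  have "(of_int (j i) + s) / real M - (of_int (j i) + r) / real M = (s - r) / real M" for i
    by (simp add: diff_divide_distrib add_divide_distrib)
  then show ?thesis
    using assms by (subst emeasure_cbox_cart) (auto simp: divide_right_mono)
qed

lemma cube_integral_indicator_Times:
  fixes A :: "(real ^ 'm::finite) set" and B :: "real set"
  assumes "A \<in> sets borel" "B \<in> sets borel" "A \<times> B \<subseteq> unit_cube"
    and "emeasure lborel A = ennreal a" "emeasure lborel B = ennreal b" "0 \<le> a" "0 \<le> b"
  shows "integrable cube_measure (indicat_real (A \<times> B))"
    "(\<integral>x. indicat_real (A \<times> B) x \<partial>cube_measure) = a * b"
proof -
  interpret cube: prob_space "cube_measure :: 'm point measure" by (rule prob_space_cube)
  have m: "A \<times> B \<in> sets cube_measure"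
    using borel_Times[OF assms(1,2)] assms(3)
    unfolding cube_measure_def by (subst sets_restrict_space_iff) auto
  then show "integrable cube_measure (indicat_real (A \<times> B))"
    by (intro integrable_real_indicator) (auto simp: cube.emeasure_finite less_top[symmetric])
  have "emeasure cube_measure (A \<times> B) = ennreal (a * b)"
    using assms by (subst emeasure_cube_measure) (auto simp: emeasure_lborel_Times ennreal_mult)
  then have "measure cube_measure (A \<times> B) = a * b" using assms by (simp add: measure_def)
  then show "(\<integral>x. indicat_real (A \<times> B) x \<partial>cube_measure) = a * b"
    using assms(3) by (simp add: Int_absorb2)
qed

definition cells :: "nat \<Rightarrow> ('m::finite \<Rightarrow> int) set" where
  "cells M = Pi UNIV (\<lambda>_. {0..<int M})"

lemma finite_cells: "finite (cells M :: ('m::finite \<Rightarrow> int) set)"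
  and card_cells: "card (cells M :: ('m::finite \<Rightarrow> int) set) = M ^ CARD('m)"
proof -
  have *: "(cells M :: ('m \<Rightarrow> int) set) = PiE UNIV (\<lambda>_. {0..<int M})"
    by (auto simp: cells_def PiE_def)
  show "finite (cells M :: ('m \<Rightarrow> int) set)" unfolding * by (intro finite_PiE) auto
  show "card (cells M :: ('m \<Rightarrow> int) set) = M ^ CARD('m)"
    unfolding * by (subst card_PiE) auto
qed

text \<open>Separates the statistical argument from regularity: of the bumps only continuity and
  height matter, at least \<open>b\<close> on the middle half of each cell and at most
  \<open>u\<close> everywhere. Both become constants times M^(-\<beta>). The condition
  \<open>g 0 = 0\<close> pins the frontier over \<open>0\<close> at \<open>a\<close> for every
  W.\<close>

locale bump_family =
  fixes M :: nat and g :: "real ^ 'm::finite \<Rightarrow> real" and a b u \<kappa> \<Delta> :: real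
  assumes M: "1 \<le> M" and a: "0 < a" and b: "0 < b" and au: "a + u \<le> 1 / 2"
    and g: "\<And>x. 0 \<le> g x" "\<And>x. g x \<le> u" and g0: "g 0 = 0"
    and gb: "\<And>x. (\<And>i. frac (real M * x $ i) \<in> {1/4..3/4}) \<Longrightarrow> b \<le> g x"
    and cont: "\<And>W. continuous_on UNIV (\<lambda>x. a + (if cell M x \<in> W then g x else 0))"
    and \<Delta>: "0 < \<Delta>" "\<Delta> \<le> 1 / 2" and \<kappa>: "0 < \<kappa>"
begin

definition frontier_fun :: "('m \<Rightarrow> int) set \<Rightarrow> real ^ 'm \<Rightarrow> real" where
  "frontier_fun W x = a + (if cell M x \<in> W then g x else 0)"

definition eta :: "('m \<Rightarrow> int) set \<Rightarrow> 'm point \<Rightarrow> real" where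
  "eta W = profile \<kappa> \<Delta> (frontier_fun W)"

lemma frontier_fun_facts:
  "continuous_on UNIV (frontier_fun W)" "a \<le> frontier_fun W x" "frontier_fun W x \<le> a + u" "frontier_fun W x \<le> 1 / 2"
  "frontier_fun W 0 = a"
proof -
  show "continuous_on UNIV (frontier_fun W)" using cont[of W] by (simp add: frontier_fun_def[abs_def])
  show "a \<le> frontier_fun W x" "frontier_fun W 0 = a" using g(1)[of x] by (auto simp: frontier_fun_def g0)
  show "frontier_fun W x \<le> a + u" using g[of x] by (auto simp: frontier_fun_def)
  then show "frontier_fun W x \<le> 1 / 2" using au by linarith
qed

lemma eta_centred: "centred_perturbation (eta W)"
  unfolding centred_perturbation_def eta_def
  using profile_measurable[OF frontier_fun_facts(1) a frontier_fun_facts(2,4) \<Delta> \<kappa>]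
    profile_abs_le[OF frontier_fun_facts(1) a frontier_fun_facts(2,4) \<Delta> \<kappa>]
    profile_integral[OF frontier_fun_facts(1) a frontier_fun_facts(2,4) \<Delta> \<kappa>]
  by (auto intro: measurable_cube_measureI)

lemma eta_in_class:
  assumes "frontier_fun W \<in> holder_ball \<beta> \<Lambda>"
  shows "perturbed_pair (eta W) \<in> pair_class \<beta> \<Lambda> \<kappa>"
  unfolding eta_def
  by (rule perturbed_pair_in_class[OF frontier_fun_facts(1) a frontier_fun_facts(2,4) \<Delta> \<kappa> assms])

text \<open>Locality of the toggles. On the column over \<open>0\<close> it rests on
  \<open>frontier_fun W 0 = a\<close>.\<close>

lemma eta_cong:
  assumes "cell M (fst x) \<in> W \<longleftrightarrow> cell M (fst x) \<in> W'"
  shows "eta W x = eta W' x"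
  using assms frontier_fun_facts(5) by (simp add: eta_def profile_def frontier_fun_def)

lemma cell_eq_box:
  fixes j :: "'m \<Rightarrow> int"
  assumes "cell M x = j"
  shows "x \<in> cbox (\<chi> i. (of_int (j i) + 0) / real M) (\<chi> i. (of_int (j i) + 1) / real M)"
proof -
  have "of_int (j i) \<le> real M * x $ i \<and> real M * x $ i \<le> of_int (j i) + 1" for i
    using assms by (auto simp: cell_def)
  then show ?thesis using M by (auto simp: mem_box_cart field_simps)
qed

lemma cell_box_subset:
  fixes j :: "'m \<Rightarrow> int"
  assumes "j \<in> cells M" "0 \<le> r" "s \<le> 1"
  shows "cbox (\<chi> i. (of_int (j i) + r) / real M) (\<chi> i. (of_int (j i) + s) / real M) \<subseteq> cbox 0 1"
proof
  fix x :: "real ^ 'm" assume x: "x \<in> cbox (\<chi> i. (of_int (j i) + r) / real M) (\<chi> i. (of_int (j i) + s) / real M)"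
  have "0 \<le> x $ i \<and> x $ i \<le> 1" for i
  proof
    have "0 \<le> j i \<and> j i < int M" using assms(1) by (auto simp: cells_def Pi_iff)
    then have j: "0 \<le> j i" "j i + 1 \<le> int M" by auto
    have "0 \<le> (of_int (j i) + r) / real M" using j assms by auto
    then show "0 \<le> x $ i" using x by (auto simp: mem_box_cart intro: order_trans)
    have "of_int (j i) + s \<le> real M" using j assms by linarith
    then have "(of_int (j i) + s) / real M \<le> 1" using M by simp
    then show "x $ i \<le> 1" using x by (auto simp: mem_box_cart intro: order_trans)
  qed
  then show "x \<in> cbox 0 1" by (simp add: mem_box_cart)
qed

text \<open>Raising the frontier from a to a + d changes \<eta> by \<Delta> (1 - d) on the swept
  band, where the sign flips, and by -\<Delta> d on the rest of the column, where the mean is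
  restored. The term \<open>u\<^sup>2\<close> pays for the latter, the indicator for the
  former.\<close>

lemma eta_diff_square:
  assumes "j \<notin> W"
  shows "(eta (insert j W) x - eta W x)\<^sup>2 \<le>
    \<Delta>\<^sup>2 * (if cell M (fst x) = j then u\<^sup>2 + (if a \<le> snd x \<and> snd x \<le> a + u then 1 else 0) else 0)"
proof (cases "cell M (fst x) = j \<and> fst x \<noteq> 0")
  case False
  have "eta (insert j W) x = eta W x"
  proof (cases "cell M (fst x) = j")
    case True
    then show ?thesis using False frontier_fun_facts(5) by (simp add: eta_def profile_def)
  qed (auto intro: eta_cong)
  then show ?thesis by simp
next
  case True
  define d where "d = g (fst x)"
  have d: "0 \<le> d" "d \<le> u" "d \<le> 1" using g[of "fst x"] a au by (auto simp: d_def)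
  have v: "frontier_fun (insert j W) (fst x) = a + d" "frontier_fun W (fst x) = a"
    using True assms by (auto simp: frontier_fun_def d_def)
  have u2: "d\<^sup>2 \<le> u\<^sup>2" using d by (intro power_mono) auto
  consider "snd x \<le> a" | "a < snd x" "snd x \<le> a + d" | "a + d < snd x" by linarith
  then have "(eta (insert j W) x - eta W x)\<^sup>2 \<le> \<Delta>\<^sup>2 * (u\<^sup>2 + (if a \<le> snd x \<and> snd x \<le> a + u then 1 else 0))"
  proof cases
    case 1
    then have "eta (insert j W) x - eta W x = - \<Delta> * d"
      using True d by (simp add: eta_def profile_def v algebra_simps)
    then have "(eta (insert j W) x - eta W x)\<^sup>2 = \<Delta>\<^sup>2 * d\<^sup>2" by (simp add: power_mult_distrib)
    then show ?thesis using u2 by (auto intro!: mult_left_mono)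
  next
    case 2
    then have "eta (insert j W) x - eta W x = \<Delta> * (1 - d)"
      using True d by (simp add: eta_def profile_def v algebra_simps)
    then have "(eta (insert j W) x - eta W x)\<^sup>2 = \<Delta>\<^sup>2 * (1 - d)\<^sup>2" by (simp add: power_mult_distrib)
    moreover have "(1 - d)\<^sup>2 \<le> u\<^sup>2 + 1"
      using d by (intro order_trans[OF power_le_one]) auto
    ultimately show ?thesis using 2 d by (auto intro!: mult_left_mono)
  next
    case 3
    then have "eta (insert j W) x - eta W x = - \<Delta> * d"
      using True d by (simp add: eta_def profile_def v algebra_simps)
    then have "(eta (insert j W) x - eta W x)\<^sup>2 = \<Delta>\<^sup>2 * d\<^sup>2" by (simp add: power_mult_distrib)
    then show ?thesis using u2 by (auto intro!: mult_left_mono)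
  qed
  then show ?thesis using True by simp
qed

text \<open>A cell has volume M^(-CARD('m)); the mean correction acts on the full height 1, the sign
  flip only on a band of height u.\<close>

lemma eta_diff_integral:
  assumes "j \<in> cells M" "j \<notin> W"
  shows "(\<integral>x. (eta (insert j W) x - eta W x)\<^sup>2 \<partial>cube_measure) \<le> \<Delta>\<^sup>2 * (u\<^sup>2 + u) / real M ^ CARD('m)"
proof -
  let ?B = "cbox (\<chi> i. (of_int (j i) + 0) / real M) (\<chi> i. (of_int (j i) + 1) / real M)"
  have u: "0 \<le> u" using g[of 0] by simp
  have em: "emeasure lborel ?B = ennreal ((1 / real M) ^ CARD('m))"
    using emeasure_lborel_box[OF M, of 0 1 j] by simp
  have sub: "?B \<subseteq> cbox 0 1" using cell_box_subset[OF assms(1), of 0 1] by simp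
  have B1: "integrable cube_measure (indicat_real (?B \<times> {0..1}))"
    "(\<integral>x. indicat_real (?B \<times> {0..1}) x \<partial>cube_measure) = (1 / real M) ^ CARD('m) * 1"
    using sub by (intro cube_integral_indicator_Times(1)[OF _ _ _ em, of _ 1]
        cube_integral_indicator_Times(2)[OF _ _ _ em, of _ 1]; auto simp: unit_cube_eq)+
  have B2: "integrable cube_measure (indicat_real (?B \<times> {a..a + u}))"
    "(\<integral>x. indicat_real (?B \<times> {a..a + u}) x \<partial>cube_measure) = (1 / real M) ^ CARD('m) * u"
    using sub a au u by (intro cube_integral_indicator_Times(1)[OF _ _ _ em, of _ u]
        cube_integral_indicator_Times(2)[OF _ _ _ em, of _ u]; auto simp: unit_cube_eq)+
  have "(\<integral>x. (eta (insert j W) x - eta W x)\<^sup>2 \<partial>cube_measure) \<le>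
    (\<integral>x. \<Delta>\<^sup>2 * (u\<^sup>2 * indicat_real (?B \<times> {0..1}) x + indicat_real (?B \<times> {a..a + u}) x) \<partial>cube_measure)"
  proof (rule integral_mono')
    show "integrable cube_measure (\<lambda>x. \<Delta>\<^sup>2 * (u\<^sup>2 * indicat_real (?B \<times> {0..1}) x + indicat_real (?B \<times> {a..a + u}) x))"
      using B1(1) B2(1) by auto
    fix x :: "'m point" assume x: "x \<in> space cube_measure"
    have "(if cell M (fst x) = j then u\<^sup>2 + (if a \<le> snd x \<and> snd x \<le> a + u then 1 else 0) else 0) \<le>
      u\<^sup>2 * indicat_real (?B \<times> {0..1}) x + indicat_real (?B \<times> {a..a + u}) x"
      using x cell_eq_box[of "fst x" j] by (cases x) (auto simp: indicator_def unit_cube_eq)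
    then show "(eta (insert j W) x - eta W x)\<^sup>2 \<le>
      \<Delta>\<^sup>2 * (u\<^sup>2 * indicat_real (?B \<times> {0..1}) x + indicat_real (?B \<times> {a..a + u}) x)"
      by (intro order_trans[OF eta_diff_square[OF assms(2)]] mult_left_mono) auto
  qed simp
  also have "\<dots> = \<Delta>\<^sup>2 * (u\<^sup>2 * (1 / real M) ^ CARD('m) + (1 / real M) ^ CARD('m) * u)"
    using B1 B2 by simp
  also have "\<dots> = \<Delta>\<^sup>2 * (u\<^sup>2 + u) / real M ^ CARD('m)"
    by (simp add: power_one_over add_divide_distrib distrib_left mult_ac)
  finally show ?thesis .
qed

section \<open>Excess risk cell by cell\<close>

definition cell_excess :: "('m \<Rightarrow> int) set \<Rightarrow> ('m \<Rightarrow> int) \<Rightarrow> ('m point \<Rightarrow> real) \<Rightarrow> real" where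
  "cell_excess W j f =
    (\<integral>x. (if cell M (fst x) = j then excess_integrand (eta W) f x else 0) \<partial>cube_measure)"

definition excess :: "('m \<Rightarrow> int) set \<Rightarrow> ('m point \<Rightarrow> real) \<Rightarrow> real" where
  "excess W f = (\<integral>x. excess_integrand (eta W) f x \<partial>cube_measure)"

lemma excess_integrand_nonneg: "0 \<le> excess_integrand (eta W) f x"
  by (simp add: excess_integrand_def)

lemma excess_integrand_cong:
  assumes "cell M (fst x) \<in> W \<longleftrightarrow> cell M (fst x) \<in> W'"
  shows "excess_integrand (eta W) f x = excess_integrand (eta W') f x"
  using eta_cong[OF assms] by (simp add: excess_integrand_def)

lemma cell_measurable:
  fixes j :: "'m \<Rightarrow> int"
  shows "(\<lambda>x. cell M (fst x) = j) \<in> measurable cube_measure (count_space UNIV)"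
proof -
  have [measurable]: "(\<lambda>x :: 'm point. fst x $ i) \<in> borel_measurable borel" for i
    by (intro borel_measurable_continuous_onI continuous_intros)
  have "(\<lambda>x :: 'm point. \<lfloor>real M * fst x $ i\<rfloor> = j i) \<in> measurable borel (count_space UNIV)" for i
    by measurable
  then have "(\<lambda>x :: 'm point. \<forall>i. \<lfloor>real M * fst x $ i\<rfloor> = j i) \<in> measurable borel (count_space UNIV)"
    by measurable
  then show ?thesis by (intro measurable_cube_measureI) (simp add: cell_def fun_eq_iff)
qed

context
  fixes f :: "'m point \<Rightarrow> real"
  assumes fm: "f \<in> borel_measurable cube_measure"
begin

lemma cell_excess_integrable:
  "integrable cube_measure (\<lambda>x. if cell M (fst x) = j then excess_integrand (eta W) f x else 0)"
proof (rule Bochner_Integration.integrable_bound[OF excess_integrand_integrable[OF eta_centred fm]])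
  have [measurable]: "excess_integrand (eta W) f \<in> borel_measurable cube_measure"
    using excess_integrand_integrable[OF eta_centred fm] by auto
  note [measurable] = cell_measurable
  show "(\<lambda>x. if cell M (fst x) = j then excess_integrand (eta W) f x else 0) \<in> borel_measurable cube_measure"
    by measurable
qed auto

lemma sum_cell_excess_le:
  assumes "finite J"
  shows "(\<Sum>j\<in>J. cell_excess W j f) \<le> excess W f"
proof -
  have "(\<Sum>j\<in>J. cell_excess W j f) =
      (\<integral>x. (\<Sum>j\<in>J. if cell M (fst x) = j then excess_integrand (eta W) f x else 0) \<partial>cube_measure)"
    unfolding cell_excess_def using cell_excess_integrable
    by (intro Bochner_Integration.integral_sum[symmetric])
  also have "\<dots> \<le> excess W f"
    unfolding excess_def
    by (intro integral_mono' excess_integrand_integrable[OF eta_centred fm])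
      (use assms excess_integrand_nonneg in auto)
  finally show ?thesis .
qed

lemma cell_excess_cong: "(j \<in> W \<longleftrightarrow> j \<in> W') \<Longrightarrow> cell_excess W j f = cell_excess W' j f"
  unfolding cell_excess_def
  by (intro Bochner_Integration.integral_cong refl) (auto intro: excess_integrand_cong)

text \<open>Outside cell j the two hypotheses have the same \<eta>, so their integrands cancel
  there.\<close>

lemma excess_diff: "excess {j} f - excess {} f = cell_excess {j} j f - cell_excess {} j f"
proof -
  have "excess {j} f - excess {} f =
      (\<integral>x. excess_integrand (eta {j}) f x - excess_integrand (eta {}) f x \<partial>cube_measure)"
    unfolding excess_def
    by (intro Bochner_Integration.integral_diff[symmetric] excess_integrand_integrable[OF eta_centred fm])
  also have "\<dots> = (\<integral>x. (if cell M (fst x) = j then excess_integrand (eta {j}) f x else 0) -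
      (if cell M (fst x) = j then excess_integrand (eta {}) f x else 0) \<partial>cube_measure)"
    by (intro Bochner_Integration.integral_cong refl) (auto intro: excess_integrand_cong)
  also have "\<dots> = cell_excess {j} j f - cell_excess {} j f"
    unfolding cell_excess_def by (intro Bochner_Integration.integral_diff cell_excess_integrable)
  finally show ?thesis .
qed

text \<open>Above the middle half of the cell, on the band between a and a + b, the two hypotheses
  have opposite signs, so every f is wrong for one of them. The error costs at least \<Delta> a,
  because a + u \<le> 1/2 gives a \<le> 1 - (a + g).\<close>

lemma cell_excess_sum_ge:
  assumes "j \<in> cells M"
  shows "\<Delta> * a * b / (2 * real M) ^ CARD('m) \<le> cell_excess {j} j f + cell_excess {} j f"
proof -
  let ?B = "cbox (\<chi> i. (of_int (j i) + 1 / 4) / real M) (\<chi> i. (of_int (j i) + 3 / 4) / real M)"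
  have inB: "cell M x = j \<and> x \<noteq> 0 \<and> b \<le> g x" if "x \<in> ?B" for x
  proof -
    have *: "of_int (j i) + 1 / 4 \<le> real M * x $ i \<and> real M * x $ i \<le> of_int (j i) + 3 / 4" for i
    proof -
      have "(of_int (j i) + 1 / 4) / real M \<le> x $ i \<and> x $ i \<le> (of_int (j i) + 3 / 4) / real M"
        using that by (auto simp: mem_box_cart)
      then show ?thesis using M by (simp add: pos_divide_le_eq pos_le_divide_eq mult.commute)
    qed
    have fl: "\<lfloor>real M * x $ i\<rfloor> = j i" for i
      using *[of i] by (intro floor_unique) auto
    have "frac (real M * x $ i) \<in> {1/4..3/4}" for i
      using *[of i] fl[of i] by (auto simp: frac_def)
    \<comment> \<open>Even in the cell at the origin the middle half stays away from
      \<open>0\<close>, so the exceptional column is not met.\<close>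
    moreover have "0 < of_int (j i) + (1 / 4 :: real)" for i
      using assms by (auto simp: cells_def Pi_iff intro!: add_nonneg_pos)
    then have "real M * x $ i \<noteq> 0" for i using *[of i] by (metis less_le_trans less_irrefl)
    then have "x \<noteq> 0" by auto
    ultimately show ?thesis using gb[of x] fl by (simp add: cell_def)
  qed
  have bu: "b \<le> u"
  proof -
    have "(\<chi> i. (of_int (j i) + 1 / 4) / real M) \<in> ?B" by (simp add: mem_box_cart divide_right_mono)
    from inB[OF this] g(2) show ?thesis by (meson order_trans)
  qed
  have em: "emeasure lborel ?B = ennreal ((1 / (2 * real M)) ^ CARD('m))"
    using emeasure_lborel_box[OF M, of "1 / 4" "3 / 4" j] by simp
  have sub: "?B \<subseteq> cbox 0 1" using cell_box_subset[OF assms, of "1 / 4" "3 / 4"] by simp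
  have subu: "?B \<times> {a<..a + b} \<subseteq> unit_cube"
    using sub a au bu unfolding unit_cube_eq by (intro Sigma_mono) auto
  have B: "integrable cube_measure (indicat_real (?B \<times> {a<..a + b}))"
    "(\<integral>x. indicat_real (?B \<times> {a<..a + b}) x \<partial>cube_measure) = (1 / (2 * real M)) ^ CARD('m) * b"
    using b by (intro cube_integral_indicator_Times(1)[OF _ _ subu em, of b]
        cube_integral_indicator_Times(2)[OF _ _ subu em, of b]; simp)+
  have "\<Delta> * a * b / (2 * real M) ^ CARD('m) = (\<integral>x. \<Delta> * a * indicat_real (?B \<times> {a<..a + b}) x \<partial>cube_measure)"
    using B by (simp add: power_one_over)
  also have "\<dots> \<le> (\<integral>x. (if cell M (fst x) = j then excess_integrand (eta {j}) f x else 0) +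
      (if cell M (fst x) = j then excess_integrand (eta {}) f x else 0) \<partial>cube_measure)"
  proof (rule integral_mono')
    show "integrable cube_measure (\<lambda>x. (if cell M (fst x) = j then excess_integrand (eta {j}) f x else 0) +
      (if cell M (fst x) = j then excess_integrand (eta {}) f x else 0))"
      by (intro Bochner_Integration.integrable_add cell_excess_integrable)
    fix x :: "'m point"
    show nonneg: "0 \<le> (if cell M (fst x) = j then excess_integrand (eta {j}) f x else 0) +
      (if cell M (fst x) = j then excess_integrand (eta {}) f x else 0)"
      using excess_integrand_nonneg by simp
    show "\<Delta> * a * indicat_real (?B \<times> {a<..a + b}) x \<le>
      (if cell M (fst x) = j then excess_integrand (eta {j}) f x else 0) +
      (if cell M (fst x) = j then excess_integrand (eta {}) f x else 0)"
    proof (cases "x \<in> ?B \<times> {a<..a + b}")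
      case True
      then have x: "cell M (fst x) = j" "fst x \<noteq> 0" "b \<le> g (fst x)" "a < snd x" "snd x \<le> a + b"
        using inB[of "fst x"] by auto
      have v: "frontier_fun {j} (fst x) = a + g (fst x)" "frontier_fun {} (fst x) = a"
        using x by (auto simp: frontier_fun_def)
      have "eta {} x = - (\<Delta> * a)" using x v by (simp add: eta_def profile_def)
      then have e0: "eta {} x < 0" "\<bar>eta {} x\<bar> = \<Delta> * a" using \<Delta> a by auto
      have "eta {j} x = \<Delta> * (1 - (a + g (fst x)))" using x v by (simp add: eta_def profile_def)
      moreover have "\<Delta> * a \<le> \<Delta> * (1 - (a + g (fst x)))"
        using \<Delta> a au g(2)[of "fst x"] g(1)[of "fst x"] by (intro mult_left_mono) auto
      moreover have "0 < \<Delta> * a" using \<Delta> a by simp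
      ultimately have e1: "0 \<le> eta {j} x" "\<Delta> * a \<le> \<bar>eta {j} x\<bar>" by auto
      show ?thesis using True x(1) e0 e1 \<Delta> a
        by (auto simp: excess_integrand_def)
    qed (use nonneg in simp)
  qed
  also have "\<dots> = cell_excess {j} j f + cell_excess {} j f"
    unfolding cell_excess_def by (intro Bochner_Integration.integral_add cell_excess_integrable)
  finally show ?thesis .
qed

text \<open>
  Only total excess risks are known to be measurable in the data, not the cellwise ones. Since the
  difference of the two candidate losses in cell \<open>j\<close> is the difference of two total excess risks,
  comparing \<open>excess {j}\<close> with \<open>excess {}\<close> is a measurable guess for whether \<open>j\<close> belongs to \<open>W\<close>.
\<close>

lemma excess_ge_errors:
  "\<Delta> * a * b / (2 * (2 * real M) ^ CARD('m)) *
    real (card {j \<in> cells M. (excess {j} f \<le> excess {} f) \<noteq> (j \<in> W)}) \<le> excess W f"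
proof -
  let ?s = "\<Delta> * a * b / (2 * (2 * real M) ^ CARD('m))"
  let ?E = "{j \<in> cells M. (excess {j} f \<le> excess {} f) \<noteq> (j \<in> W)}"
  have "?s \<le> cell_excess W j f" if j: "j \<in> ?E" for j
  proof -
    have "?s = \<Delta> * a * b / (2 * real M) ^ CARD('m) / 2" by simp
    then have s: "2 * ?s \<le> cell_excess {j} j f + cell_excess {} j f"
      using cell_excess_sum_ge[of j] j by simp
    \<comment> \<open>A wrong guess means that the loss under the true state of the cell is at least
      the loss under the other state, hence at least half of their sum.\<close>
    show ?thesis
    proof (cases "j \<in> W")
      case True
      then have "cell_excess {} j f < cell_excess {j} j f" using j excess_diff[of j] by auto
      then show ?thesis using s cell_excess_cong[of j W "{j}"] True by simp
    next
      case False
      then have "cell_excess {j} j f \<le> cell_excess {} j f" using j excess_diff[of j] by auto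
      then show ?thesis using s cell_excess_cong[of j W "{}"] False by simp
    qed
  qed
  then have "real (card ?E) * ?s \<le> (\<Sum>j\<in>?E. cell_excess W j f)" by (intro sum_bounded_below)
  also have "\<dots> \<le> excess W f" by (intro sum_cell_excess_le finite_subset[OF _ finite_cells[of M]]) auto
  finally show ?thesis by (simp add: mult.commute)
qed

end

text \<open>A quarter of the M^CARD('m) cells is misjudged on average under some W. Their number
  cancels the factor M^(-CARD('m)) in the cost of one error, which leaves a bound of order \<Delta>
  b.\<close>

lemma expected_excess_lower_bound:
  assumes n: "real n * (\<Delta>\<^sup>2 * (u\<^sup>2 + u) / real M ^ CARD('m)) \<le> 1 / 16"
    and fhat: "fhat \<in> estimators \<P> n \<F>" and \<P>: "\<And>W. perturbed_pair (eta W) \<in> \<P>"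
  shows "\<exists>W. \<Delta> * a * b / (8 * 2 ^ CARD('m)) \<le>
    expected_excess_risk (fst (perturbed_pair (eta W))) (snd (perturbed_pair (eta W))) n fhat"
proof -
  let ?N = "\<Pi>\<^sub>M i \<in> {..<n}. label_measure"
  let ?s = "\<Delta> * a * b / (2 * (2 * real M) ^ CARD('m))"
  let ?P = "\<lambda>W. perturbed_data_law (eta W) n"
  define X where "X W z = excess_risk (fst (perturbed_pair (eta W))) (snd (perturbed_pair (eta W))) (fhat z)" for W z
  have est: "(\<forall>z \<in> space (?P W). fhat z \<in> borel_measurable cube_measure) \<and> X W \<in> borel_measurable (?P W)" for W
    using fhat \<P>[of W] unfolding estimators_def X_def[abs_def] by fastforce
  have fm: "fhat z \<in> borel_measurable cube_measure" if "z \<in> space ?N" for z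
    using est[of "{}"] that by (simp add: space_data_law)
  \<comment> \<open>Each excess risk is measurable only for the data law of its own hypothesis, but
    all data laws share one sigma-algebra. This allows risks of two hypotheses to be compared in a
    single test.\<close>
  have Xm [measurable]: "X W \<in> borel_measurable ?N" for W
    using est[of W] by (simp cong: measurable_cong_sets add: sets_data_law)
  have Xe: "X W z = excess W (fhat z)" if "z \<in> space ?N" for W z
    unfolding X_def excess_def by (rule excess_risk_eq[OF eta_centred fm[OF that]])
  define T where "T j = {z \<in> space ?N. X {j} z \<le> X {} z}" for j
  have T: "T j \<in> sets ?N" for j unfolding T_def by measurable
  have "\<exists>W\<subseteq>cells M. real (card (cells M :: ('m \<Rightarrow> int) set)) / 4 \<le>
      (\<Sum>j\<in>cells M. measure (?P W) (if j \<in> W then space ?N - T j else T j))"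
  proof (rule assouad[OF finite_cells])
    fix W and j :: "'m \<Rightarrow> int" assume j: "j \<in> cells M" "j \<notin> W"
    then have "real n * (\<integral>x. (eta (insert j W) x - eta W x)\<^sup>2 \<partial>cube_measure) \<le>
        real n * (\<Delta>\<^sup>2 * (u\<^sup>2 + u) / real M ^ CARD('m))"
      by (intro mult_left_mono eta_diff_integral) auto
    then have "real n * (\<integral>x. (eta (insert j W) x - eta W x)\<^sup>2 \<partial>cube_measure) \<le> 1 / 16"
      using n by (rule order_trans)
    from perturbed_testing_error[OF eta_centred eta_centred this] T[of j]
    show "1 / 2 \<le> measure (?P W) (T j) + measure (?P (insert j W)) (space ?N - T j)"
      unfolding sets_data_law space_data_law by blast
  qed
  then obtain W where W: "real (card (cells M :: ('m \<Rightarrow> int) set)) / 4 \<le>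
      (\<Sum>j\<in>cells M. measure (?P W) (if j \<in> W then space ?N - T j else T j))" by blast
  interpret P: prob_space "?P W" by (rule prob_space_perturbed_data_law[OF eta_centred])
  \<comment> \<open>The event of a wrong guess about cell j under W; the sum of these indicators is
    the error count of \<open>excess_ge_errors\<close>.\<close>
  define E where "E j = (if j \<in> W then space ?N - T j else T j)" for j
  have E: "E j \<in> sets (?P W)" for j using T by (auto simp: E_def sets_data_law)
  have intE: "integrable (?P W) (indicat_real (E j))" for j
    using E by (intro integrable_real_indicator) (auto simp: P.emeasure_finite less_top[symmetric])
  have "?s * (real (card (cells M :: ('m \<Rightarrow> int) set)) / 4) \<le> ?s * (\<Sum>j\<in>cells M. measure (?P W) (E j))"
    using W \<Delta> a b unfolding E_def by (intro mult_left_mono) auto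
  also have "\<dots> = (\<integral>z. ?s * (\<Sum>j\<in>cells M. indicat_real (E j) z) \<partial>?P W)"
  proof -
    have "measure (?P W) (E j) = (\<integral>z. indicat_real (E j) z \<partial>?P W)" for j
      using sets.sets_into_space[OF E[of j]] by (simp add: Int_absorb2)
    then show ?thesis using intE by (simp add: Bochner_Integration.integral_sum)
  qed
  also have "\<dots> \<le> (\<integral>z. X W z \<partial>?P W)"
  proof (rule integral_mono')
    show "integrable (?P W) (X W)"
    proof (rule P.integrable_const_bound[where B = 2])
      show "AE z in ?P W. norm (X W z) \<le> 2"
      proof (rule AE_I2)
        fix z
        interpret Q: prob_space "perturbed_law (eta W)" by (rule prob_space_perturbed_law[OF eta_centred])
        have "0 \<le> risk (fst (perturbed_pair (eta W))) (snd (perturbed_pair (eta W))) c \<and>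
            risk (fst (perturbed_pair (eta W))) (snd (perturbed_pair (eta W))) c \<le> 1" for c
          by (simp add: risk_def Q.prob_le_1)
        then show "norm (X W z) \<le> 2"
          unfolding X_def excess_risk_def real_norm_def by (smt (verit))
      qed
    qed (use est in blast)
    fix z assume "z \<in> space (?P W)"
    then have z: "z \<in> space ?N" by (simp add: space_data_law)
    have "(\<Sum>j\<in>cells M. indicat_real (E j) z) =
        real (card {j \<in> cells M. (excess {j} (fhat z) \<le> excess {} (fhat z)) \<noteq> (j \<in> W)})"
    proof -
      have "indicat_real (E j) z = (if (excess {j} (fhat z) \<le> excess {} (fhat z)) \<noteq> (j \<in> W) then 1 else 0)" for j
        using z by (auto simp: E_def T_def Xe)
      then show ?thesis by (simp add: sum.inter_filter[OF finite_cells, symmetric])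
    qed
    then show "?s * (\<Sum>j\<in>cells M. indicat_real (E j) z) \<le> X W z"
      using excess_ge_errors[OF fm[OF z], of W] by (simp only: Xe[OF z])
    show "0 \<le> X W z"
      unfolding Xe[OF z] excess_def using excess_integrand_nonneg by simp
  qed
  also have "\<dots> = expected_excess_risk (fst (perturbed_pair (eta W))) (snd (perturbed_pair (eta W))) n fhat"
    by (simp add: expected_excess_risk_def X_def)
  finally have "?s * (real (card (cells M :: ('m \<Rightarrow> int) set)) / 4) \<le>
    expected_excess_risk (fst (perturbed_pair (eta W))) (snd (perturbed_pair (eta W))) n fhat" .
  moreover have "?s * (real (card (cells M :: ('m \<Rightarrow> int) set)) / 4) = \<Delta> * a * b / (8 * 2 ^ CARD('m))"
    using M by (simp add: card_cells power_mult_distrib)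
  ultimately show ?thesis by auto
qed

end

text \<open>The divergence is n M^(-D/\<kappa>), since D/\<kappa> = 2 \<beta>/\<kappa> + \<beta> +
  m; this dictates M = n^(\<kappa>/D), rounded up. The excess M^(-\<beta> - \<beta>/\<kappa>) then
  has exponent \<beta> (\<kappa> + 1) / D in 1/n.\<close>

lemma rate_parameters:
  fixes \<beta> \<kappa> m :: real and n :: nat
  assumes "\<beta> > 0" "\<kappa> > 0" "m \<ge> 0" "n \<ge> 1"
  defines "D \<equiv> \<beta> * (\<kappa> + 2) + m * \<kappa>"
  obtains M :: nat where "1 \<le> M"
    "real n * (real M powr (- \<beta> / \<kappa>))\<^sup>2 * real M powr - \<beta> / real M powr m \<le> 1"
    "2 powr (- \<beta> - \<beta> / \<kappa>) * (1 / real n) powr (\<beta> * (\<kappa> + 1) / D) \<le>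
      real M powr (- \<beta> / \<kappa>) * real M powr - \<beta>"
proof -
  define r where "r = real n powr (\<kappa> / D)"
  define M where "M = nat \<lceil>r\<rceil>"
  have D: "0 < D" using assms by (auto simp: D_def intro!: add_pos_nonneg mult_pos_pos)
  have r: "1 \<le> r" unfolding r_def using assms D by (intro ge_one_powr_ge_zero) auto
  \<comment> \<open>As r \<ge> 1, rounding up at most doubles it; this is the source of the factor
    2^(-\<beta> - \<beta>/\<kappa>).\<close>
  have M: "r \<le> real M" "real M \<le> 2 * r" using r by (auto simp: M_def) linarith+
  have M1: "1 \<le> M" using M(1) r by linarith
  have "real n = r powr (D / \<kappa>)"
    using assms D by (simp add: r_def powr_powr)
  also have "\<dots> \<le> real M powr (D / \<kappa>)" using M r D assms by (intro powr_mono2) auto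
  finally have nM: "real n \<le> real M powr (D / \<kappa>)" .
  have "real n * (real M powr (- \<beta> / \<kappa>))\<^sup>2 * real M powr - \<beta> / real M powr m =
      real n * real M powr (- (D / \<kappa>))"
  proof -
    have "(real M powr (- \<beta> / \<kappa>))\<^sup>2 * real M powr - \<beta> / real M powr m =
        real M powr (2 * (- \<beta> / \<kappa>) - \<beta> - m)"
      using M1 by (simp add: powr_diff powr_minus_divide power2_eq_square flip: powr_add)
    moreover have "2 * (- \<beta> / \<kappa>) - \<beta> - m = - (D / \<kappa>)"
      using assms by (simp add: D_def field_simps)
    ultimately show ?thesis by (simp only: mult.assoc times_divide_eq_right[symmetric])
  qed
  also have "\<dots> \<le> real M powr (D / \<kappa>) * real M powr (- (D / \<kappa>))"
    using nM by (intro mult_right_mono) auto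
  also have "\<dots> = 1" using M1 by (simp flip: powr_add)
  finally have 1: "real n * (real M powr (- \<beta> / \<kappa>))\<^sup>2 * real M powr - \<beta> / real M powr m \<le> 1" .
  have "2 powr (- \<beta> - \<beta> / \<kappa>) * (1 / real n) powr (\<beta> * (\<kappa> + 1) / D) =
      2 powr (- \<beta> - \<beta> / \<kappa>) * r powr (- \<beta> - \<beta> / \<kappa>)"
  proof -
    have e: "\<kappa> / D * (- \<beta> - \<beta> / \<kappa>) = - (\<beta> * (\<kappa> + 1) / D)"
    proof -
      have "\<kappa> * (- \<beta> - \<beta> / \<kappa>) = - (\<beta> * (\<kappa> + 1))"
        using \<open>0 < \<kappa>\<close> by (simp add: distrib_left right_diff_distrib mult.commute)
      then show ?thesis by (simp only: times_divide_eq_left minus_divide_left)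
    qed
    have "r powr (- \<beta> - \<beta> / \<kappa>) = real n powr (- (\<beta> * (\<kappa> + 1) / D))"
      unfolding r_def powr_powr e ..
    then show ?thesis using assms by (simp add: powr_minus_divide powr_divide)
  qed
  also have "\<dots> = (2 * r) powr (- \<beta> - \<beta> / \<kappa>)" using r by (simp add: powr_mult)
  also have "\<dots> \<le> real M powr (- \<beta> - \<beta> / \<kappa>)"
    using M M1 \<open>0 < \<beta>\<close> divide_pos_pos[OF \<open>0 < \<beta>\<close> \<open>0 < \<kappa>\<close>] by (intro powr_mono2') auto
  also have "\<dots> = real M powr (- \<beta> / \<kappa>) * real M powr - \<beta>"
    by (simp flip: powr_add add: add.commute)
  finally show ?thesis using that[OF M1 1] by blast
qed

theorem theorem3p4:
  fixes d :: nat and \<beta> \<Lambda> \<kappa> :: real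
    and \<F> :: "('m::finite point \<Rightarrow> real) set"
  assumes "d \<ge> 2" and "CARD('m) = d - 1"
    and "\<beta> > 0" and "\<Lambda> > 0" and "\<kappa> > 0"
  shows "\<exists>c>0. \<forall>\<^sub>F n in sequentially.
    (INF fhat \<in> estimators (pair_class \<beta> \<Lambda> \<kappa>) n \<F>.
       SUP (p, q) \<in> pair_class \<beta> \<Lambda> \<kappa>. ereal (expected_excess_risk p q n fhat))
    \<ge> ereal (c * (1 / real n) powr
        (\<beta> * (\<kappa> + 1) / (\<beta> * (\<kappa> + 2) + real (d - 1) * \<kappa>)))"
proof -
  obtain a c \<rho> :: real and g :: "nat \<Rightarrow> real ^ 'm \<Rightarrow> real" where
    a: "0 < a" and c: "0 < c" and \<rho>: "0 < \<rho>" "a + \<rho> \<le> 1 / 2"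
    and g: "\<And>M x. 0 \<le> g M x \<and> g M x \<le> \<rho> * real M powr - \<beta>"
    and gb: "\<And>M x. (\<And>i. frac (real M * x $ i) \<in> {1/4..3/4}) \<Longrightarrow> c * real M powr - \<beta> \<le> g M x"
    and g0: "\<And>M. g M 0 = 0"
    and hol: "\<And>M W. 1 \<le> M \<Longrightarrow> (\<lambda>x. a + (if cell M x \<in> W then g M x else 0)) \<in> holder_ball \<beta> \<Lambda>"
    and cont: "\<And>M W. 1 \<le> M \<Longrightarrow> continuous_on UNIV (\<lambda>x. a + (if cell M x \<in> W then g M x else 0))"
    using holder_bumps[OF \<open>\<beta> > 0\<close> \<open>\<Lambda> > 0\<close>] by blast
  \<comment> \<open>The 32 is the 8 of \<open>expected_excess_lower_bound\<close> times the 4 in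
    \<Delta>; the power of 2 is the rounding loss in \<open>rate_parameters\<close>.\<close>
  define K where "K = a * c / (32 * 2 ^ CARD('m)) * 2 powr (- \<beta> - \<beta> / \<kappa>)"
  define e where "e = \<beta> * (\<kappa> + 1) / (\<beta> * (\<kappa> + 2) + real (d - 1) * \<kappa>)"
  have "0 < K" using a c by (simp add: K_def)
  moreover have "ereal (K * (1 / real n) powr e) \<le>
    (INF fhat \<in> estimators (pair_class \<beta> \<Lambda> \<kappa>) n \<F>.
       SUP (p, q) \<in> pair_class \<beta> \<Lambda> \<kappa>. ereal (expected_excess_risk p q n fhat))" if n: "1 \<le> n" for n
  \<comment> \<open>This also covers an empty set of estimators, whose infimum is
    \<infinity>.\<close>
  proof (rule INF_greatest)
    fix fhat assume fhat: "fhat \<in> estimators (pair_class \<beta> \<Lambda> \<kappa>) n \<F>"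
    obtain M :: nat where M: "1 \<le> M"
      and nM: "real n * (real M powr (- \<beta> / \<kappa>))\<^sup>2 * real M powr - \<beta> / real M powr real CARD('m) \<le> 1"
      and rate: "2 powr (- \<beta> - \<beta> / \<kappa>) * (1 / real n) powr e \<le> real M powr (- \<beta> / \<kappa>) * real M powr - \<beta>"
      using rate_parameters[of \<beta> \<kappa> "real CARD('m)" n] assms n unfolding e_def by (metis of_nat_0_le_iff)
    \<comment> \<open>The divisor 4 turns the bound 1 in \<open>nM\<close> into the 1/16 required by
      \<open>expected_excess_lower_bound\<close>.\<close>
    define \<Delta> where "\<Delta> = real M powr (- \<beta> / \<kappa>) / 4"
    define u where "u = \<rho> * real M powr - \<beta>"
    have pow1: "real M powr - \<beta> \<le> 1" "real M powr (- \<beta> / \<kappa>) \<le> 1"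
      using M assms powr_mono[of "- \<beta>" 0 "real M"] powr_mono[of "- \<beta> / \<kappa>" 0 "real M"] by auto
    have \<Delta>: "0 < \<Delta>" "\<Delta> \<le> 1 / 2" using M pow1 by (auto simp: \<Delta>_def)
    have u\<rho>: "u \<le> \<rho> * 1" unfolding u_def using pow1 \<rho> by (intro mult_left_mono) auto
    then have au: "a + u \<le> 1 / 2" using \<rho> by simp
    have u0: "0 \<le> u" using \<rho> by (simp add: u_def)
    have b: "0 < c * real M powr - \<beta>" using c M by simp
    have gM: "\<And>x. 0 \<le> g M x" "\<And>x. g M x \<le> u" using g by (auto simp: u_def)
    interpret bump_family M "g M" a "c * real M powr - \<beta>" u \<kappa> \<Delta>
    proof
      show "c * real M powr - \<beta> \<le> g M x" if "\<And>i. frac (real M * x $ i) \<in> {1/4..3/4}" for x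
        using that by (rule gb)
    qed (use M a b au gM g0 cont[OF M] \<Delta> \<open>\<kappa> > 0\<close> in auto)
    have small: "real n * (\<Delta>\<^sup>2 * (u\<^sup>2 + u) / real M ^ CARD('m)) \<le> 1 / 16"
    proof -
      have "u\<^sup>2 + u \<le> real M powr - \<beta>"
      proof -
        \<comment> \<open>u \<le> \<rho> \<le> 1/2 gives u^2 \<le> u, and then 2 \<rho> \<le> 1
          absorbs the term from the mean correction.\<close>
        have "u * u \<le> u * 1" using u0 u\<rho> \<rho> a by (intro mult_left_mono) auto
        then have "u\<^sup>2 + u \<le> (2 * \<rho>) * real M powr - \<beta>" by (simp add: power2_eq_square u_def)
        also have "\<dots> \<le> 1 * real M powr - \<beta>" using \<rho> a by (intro mult_right_mono) auto
        finally show ?thesis by simp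
      qed
      then have "real n * (\<Delta>\<^sup>2 * (u\<^sup>2 + u) / real M ^ CARD('m)) \<le>
          real n * (\<Delta>\<^sup>2 * real M powr - \<beta> / real M ^ CARD('m))"
        by (intro mult_left_mono divide_right_mono) auto
      also have "\<dots> = real n * (real M powr (- \<beta> / \<kappa>))\<^sup>2 * real M powr - \<beta> / real M powr real CARD('m) / 16"
        using M by (simp add: \<Delta>_def power_divide powr_realpow)
      also have "\<dots> \<le> 1 / 16" by (rule divide_right_mono[OF nM]) simp
      finally show ?thesis .
    qed
    have cls: "perturbed_pair (eta W) \<in> pair_class \<beta> \<Lambda> \<kappa>" for W
      using hol[OF M, of W] by (intro eta_in_class) (simp add: frontier_fun_def[abs_def])
    obtain W where W: "\<Delta> * a * (c * real M powr - \<beta>) / (8 * 2 ^ CARD('m)) \<le>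
        expected_excess_risk (fst (perturbed_pair (eta W))) (snd (perturbed_pair (eta W))) n fhat"
      using expected_excess_lower_bound[OF small fhat cls] by blast
    have "K * (1 / real n) powr e = a * c / (32 * 2 ^ CARD('m)) * (2 powr (- \<beta> - \<beta> / \<kappa>) * (1 / real n) powr e)"
      by (simp add: K_def)
    also have "\<dots> \<le> a * c / (32 * 2 ^ CARD('m)) * (real M powr (- \<beta> / \<kappa>) * real M powr - \<beta>)"
      using a c by (intro mult_left_mono rate) auto
    also have "\<dots> = \<Delta> * a * (c * real M powr - \<beta>) / (8 * 2 ^ CARD('m))"
      by (simp add: \<Delta>_def)
    also note W
    finally have "K * (1 / real n) powr e \<le>
        expected_excess_risk (fst (perturbed_pair (eta W))) (snd (perturbed_pair (eta W))) n fhat" .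
    then show "ereal (K * (1 / real n) powr e) \<le>
        (SUP (p, q) \<in> pair_class \<beta> \<Lambda> \<kappa>. ereal (expected_excess_risk p q n fhat))"
      by (intro SUP_upper2[OF cls[of W]]) (simp add: case_prod_beta)
  qed
  ultimately show ?thesis
    unfolding e_def by (intro exI[of _ K] conjI eventually_sequentiallyI[of 1]) auto
qed

end
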